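(* Let $p>1$ and let $f(t)=t^p$ for $t\ge 0$. For a bounded convex set $\Omega\subset\mathbb{R}^2$ whose boundary $\partial\Omega$ is a closed curve of class $W^{2,p}$, set $E_f(\partial\Omega)=\int_{\partial\Omega} f(\kappa(s))\,ds=\int_{\partial\Omega}\kappa(s)^p\,ds$, where $s$ is arc length and $\kappa\ge 0$ is the curvature of $\partial\Omega$. Then for every $a>0$, among all convex sets $\Omega$ of area $a$ with boundary of class $W^{2,p}$, the disc of area $a$ minimizes $E_f(\partial\Omega)$, and it is the only minimizer.
   Context: For a planar regular closed curve $\gamma$ parametrized by arc length, with unit tangent $\mathbf t=\gamma'$ and unit normal $\mathbf n$ chosen so that $(\mathbf t,\mathbf n)$ is positively oriented, the signed curvature is defined by $\mathbf t'(s)=\kappa(s)\mathbf n(s)$. For the counterclockwise-oriented boundary of a convex set, $\kappa\ge 0$. *)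

theory Defs
  imports "HOL-Complex_Analysis.Complex_Analysis"
begin

text \<open>The plane is modelled as the complex numbers.  A closed curve of class W^{2,p}
 parametrized by arc length on [0,L]: gamma is differentiable with unit tangent T,
 T is absolutely continuous with T(s) = T(0) + integral of g over [0,s], where g is
 a Lebesgue integrable function with |g|^p integrable (i.e. g = gamma'' in L^p),
 and the closed curve is C^1-closed (gamma 0 = gamma L, T 0 = T L).\<close>

definition arclength_W2p_closed_curve ::
  "real \<Rightarrow> (real \<Rightarrow> complex) \<Rightarrow> real \<Rightarrow> (real \<Rightarrow> complex) \<Rightarrow> (real \<Rightarrow> complex) \<Rightarrow> bool"
where
  "arclength_W2p_closed_curve p \<gamma> L T g \<longleftrightarrow>
     L > 0 \<and>
     (\<forall>s\<in>{0..L}. (\<gamma> has_vector_derivative T s) (at s within {0..L})) \<and>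
     (\<forall>s\<in>{0..L}. norm (T s) = 1) \<and>
     \<gamma> 0 = \<gamma> L \<and> T 0 = T L \<and>
     g absolutely_integrable_on {0..L} \<and>
     (\<lambda>s. norm (g s) powr p) integrable_on {0..L} \<and>
     (\<forall>s\<in>{0..L}. T s = T 0 + integral {0..s} g)"

text \<open>Signed curvature: t' = kappa n with n = i t, hence kappa = Im (conj t * t').\<close>
definition curvature :: "(real \<Rightarrow> complex) \<Rightarrow> (real \<Rightarrow> complex) \<Rightarrow> real \<Rightarrow> real" where
  "curvature T g s = Im (cnj (T s) * g s)"

definition unit_path :: "(real \<Rightarrow> complex) \<Rightarrow> real \<Rightarrow> real \<Rightarrow> complex" where
  "unit_path \<gamma> L = (\<lambda>t. \<gamma> (L * t))"

definition convex_W2p_boundary_param ::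
  "real \<Rightarrow> complex set \<Rightarrow> (real \<Rightarrow> complex) \<Rightarrow> real \<Rightarrow> (real \<Rightarrow> complex) \<Rightarrow> (real \<Rightarrow> complex) \<Rightarrow> bool"
where
  "convex_W2p_boundary_param p \<Omega> \<gamma> L T g \<longleftrightarrow>
     bounded \<Omega> \<and> convex \<Omega> \<and>
     arclength_W2p_closed_curve p \<gamma> L T g \<and>
     simple_path (unit_path \<gamma> L) \<and>
     path_image (unit_path \<gamma> L) = frontier \<Omega> \<and>
     (\<forall>z\<in>interior \<Omega>. winding_number (unit_path \<gamma> L) z = 1)"

definition energy_p :: "real \<Rightarrow> real \<Rightarrow> (real \<Rightarrow> complex) \<Rightarrow> (real \<Rightarrow> complex) \<Rightarrow> real" where
  "energy_p p L T g = integral {0..L} (\<lambda>s. curvature T g s powr p)"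

end

theory Submission
  imports Defs
begin

text \<open>Cut the boundary at two points with opposite tangents. Each of the two arcs, with length \<open>l\<close>,
  together with its point reflection in the midpoint of the chord bounds a centrally symmetric convex
  set of area \<open>2A\<close>, whose support function \<open>h\<close> satisfies Bonnesen's inequality
  \<open>A + \<pi>h\<^sup>2/2 \<le> l h\<close>, that is, \<open>\<bar>l/\<pi> - h\<bar> \<le> \<delta>\<close> with \<open>\<delta>\<^sup>2 = l\<^sup>2/\<pi>\<^sup>2 - 2A/\<pi>\<close>. Since \<open>\<integral>\<kappa> = \<pi>\<close>, \<open>\<integral>\<kappa>h = l\<close> and
  \<open>\<integral>h = 2A\<close>, the function \<open>u = (l/\<pi> - h)/\<delta>\<close> has \<open>\<bar>u\<bar> \<le> 1\<close>, \<open>\<integral>\<kappa>u = 0\<close> and \<open>\<integral>u = \<pi>\<delta>\<close>. Following Green and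
  Osher, the tangent line inequality for \<open>t\<^sup>p\<close> at \<open>1/x\<close> and \<open>1/y\<close>, where \<open>x = l/\<pi> + \<delta>\<close> and
  \<open>y = l/\<pi> - \<delta>\<close>, integrated with the weights \<open>(1 \<plusminus> u)/2\<close>, bounds the energy of the arc below by
  \<open>\<pi>/2 (x\<^bsup>1-p\<^esup> + y\<^bsup>1-p\<^esup>)\<close>, hence by \<open>\<pi> (2A/\<pi>)\<^bsup>(1-p)/2\<^esup>\<close> because \<open>xy = 2A/\<pi>\<close>. This is a convex
  function of \<open>A\<close>, so the two arcs together have at least the energy of the disc; in the case of equality
  the curvature is constant almost everywhere.\<close>

section \<open>Primitives of integrable functions\<close>

text \<open>For a general convex set Bonnesen's inequality holds at radii between the inradius and
  the circumradius, and a support function taken from an arbitrary origin may leave that range.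
  Central symmetry about the origin keeps it inside, which is why the curve is cut at opposite
  tangents and each arc is doubled by a reflection. Under the weights \<open>(1 + u) / 2\<close> and
  \<open>(1 - u) / 2\<close> the means of the curvature are exactly \<open>1 / x\<close> and
  \<open>1 / y\<close>, so the two tangent line inequalities are instances of Jensen's inequality. A
  second difficulty is regularity: the curvature is only an L^p function, known almost everywhere,
  and neither its sign nor the total turning is part of the definitions. Both are derived from
  convexity and winding number one, and the area has to be identified with a boundary
  integral.\<close>

lemma norm_diff_le_of_local:
  fixes H :: "real \<Rightarrow> 'a::real_normed_vector" and M :: "real \<Rightarrow> real"
  assumes "a \<le> b" "\<delta> > 0"
    and loc: "\<And>s t. a \<le> s \<Longrightarrow> s \<le> t \<Longrightarrow> t \<le> b \<Longrightarrow> t - s < \<delta> \<Longrightarrow> norm (H t - H s) \<le> M t - M s"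
  shows "norm (H b - H a) \<le> M b - M a"
proof -
  obtain n :: nat where n: "(b - a) / \<delta> < real n"
    using reals_Archimedean2 by blast
  have npos: "real n > 0"
    using n assms(1,2) by (metis divide_nonneg_pos diff_ge_0_iff_ge le_less_trans)
  define d where "d = (b - a) / n"
  have d: "0 \<le> d" "d < \<delta>" "a + n * d = b"
    using n npos assms(1,2) by (auto simp: d_def field_simps)
  have "k \<le> n \<Longrightarrow> norm (H (a + k * d) - H a) \<le> M (a + k * d) - M a" for k :: nat
  proof (induction k)
    case (Suc k)
    have "real (Suc k) * d \<le> n * d"
      using Suc.prems d(1) by (intro mult_right_mono) auto
    then have "norm (H (a + Suc k * d) - H (a + k * d)) \<le> M (a + Suc k * d) - M (a + k * d)"
      using d by (intro loc) (auto simp: algebra_simps)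
    moreover have "norm (H (a + Suc k * d) - H a)
        \<le> norm (H (a + Suc k * d) - H (a + k * d)) + norm (H (a + k * d) - H a)"
      by norm
    ultimately show ?case using Suc by simp
  qed simp
  from this[of n] show ?thesis using d(3) by simp
qed

text \<open>A fine partition bounds the total increment of \<open>H\<close> by \<epsilon> times that
  of the fixed function \<open>M\<close>, for every \<epsilon>. With \<open>M\<close> a primitive of
  the norms of the densities this yields product and chain rules for absolutely continuous functions
  without pointwise derivatives.\<close>

lemma eq_of_local_small:
  fixes H :: "real \<Rightarrow> 'a::real_normed_vector" and M :: "real \<Rightarrow> real"
  assumes "a \<le> b"
    and loc: "\<And>\<epsilon>. \<epsilon> > 0 \<Longrightarrow> \<exists>\<delta>>0. \<forall>s t. a \<le> s \<longrightarrow> s \<le> t \<longrightarrow> t \<le> b \<longrightarrow> t - s < \<delta> \<longrightarrow>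
                norm (H t - H s) \<le> \<epsilon> * (M t - M s)"
  shows "H b = H a"
proof -
  have le: "norm (H b - H a) \<le> \<epsilon> * (M b - M a)" if \<epsilon>: "\<epsilon> > 0" for \<epsilon> :: real
  proof -
    obtain \<delta> where "\<delta> > 0" and "\<forall>s t. a \<le> s \<longrightarrow> s \<le> t \<longrightarrow> t \<le> b \<longrightarrow> t - s < \<delta> \<longrightarrow>
                norm (H t - H s) \<le> \<epsilon> * (M t - M s)" using loc[OF \<epsilon>] by blast
    then have "norm (H b - H a) \<le> \<epsilon> * M b - \<epsilon> * M a"
      using assms(1) by (intro norm_diff_le_of_local[of a b \<delta> H "\<lambda>t. \<epsilon> * M t"]) (auto simp: algebra_simps)
    then show ?thesis by (simp add: algebra_simps)
  qed
  have "norm (H b - H a) \<le> 0 + e" if "e > 0" for e :: real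
  proof -
    define \<epsilon> where "\<epsilon> = e / (\<bar>M b - M a\<bar> + 1)"
    have "\<epsilon> > 0" using that by (simp add: \<epsilon>_def add_nonneg_pos)
    from le[OF this] have "norm (H b - H a) \<le> \<epsilon> * (\<bar>M b - M a\<bar> + 1)"
      using \<open>\<epsilon> > 0\<close> by (smt (verit) mult_left_mono)
    also have "\<dots> = e" by (simp add: \<epsilon>_def add_nonneg_eq_0_iff)
    finally show ?thesis by simp
  qed
  then have "norm (H b - H a) \<le> 0" by (rule field_le_epsilon)
  then show ?thesis by simp
qed

text \<open>Absolute continuity of \<open>F\<close> with almost everywhere derivative
  \<open>f\<close>, stated through integrals. Only the class of \<open>f\<close> modulo null sets
  matters, which suits a curvature in L^p.\<close>

definition primitive_on :: "(real \<Rightarrow> 'a::euclidean_space) \<Rightarrow> (real \<Rightarrow> 'a) \<Rightarrow> real \<Rightarrow> real \<Rightarrow> bool" where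
  "primitive_on F f a b \<longleftrightarrow>
     f absolutely_integrable_on {a..b} \<and> (\<forall>s\<in>{a..b}. F s = F a + integral {a..s} f)"

lemma primitive_on_absint: "primitive_on F f a b \<Longrightarrow> f absolutely_integrable_on {a..b}"
  by (simp add: primitive_on_def)

lemma primitive_on_integrable: "primitive_on F f a b \<Longrightarrow> f integrable_on {a..b}"
  by (simp add: primitive_on_def set_lebesgue_integral_eq_integral(1))

lemma primitive_onD: "primitive_on F f a b \<Longrightarrow> s \<in> {a..b} \<Longrightarrow> F s = F a + integral {a..s} f"
  unfolding primitive_on_def by blast

lemma primitive_on_has_integral:
  assumes F: "primitive_on F f a b" and st: "a \<le> s" "s \<le> t" "t \<le> b"
  shows "(f has_integral (F t - F s)) {s..t}"
proof -
  have i: "f integrable_on {a..t}" 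
    using primitive_on_integrable[OF F] st by (auto elim: integrable_on_subinterval)
  have "integral {a..s} f + integral {s..t} f = integral {a..t} f"
    using Henstock_Kurzweil_Integration.integral_combine[OF st(1,2) i] .
  moreover have "F s = F a + integral {a..s} f" "F t = F a + integral {a..t} f"
    by (rule primitive_onD[OF F]; use st in simp)+
  moreover have "f integrable_on {s..t}"
    using i st by (auto elim: integrable_on_subinterval)
  ultimately show ?thesis
    by (metis add_diff_cancel_left add_diff_cancel_left' integrable_integral)
qed

lemmas primitive_on_integral = primitive_on_has_integral[THEN integral_unique]

lemma primitive_onI:
  assumes "f absolutely_integrable_on {a..b}"
    and "\<And>s. a \<le> s \<Longrightarrow> s \<le> b \<Longrightarrow> (f has_integral (F s - F a)) {a..s}"
  shows "primitive_on F f a b"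
  unfolding primitive_on_def
proof (intro conjI ballI)
  fix s assume "s \<in> {a..b}"
  then show "F s = F a + integral {a..s} f"
    using integral_unique[OF assms(2)[of s]] by simp
qed fact

lemma primitive_on_continuous:
  assumes "primitive_on F f a b"
  shows "continuous_on {a..b} F"
proof -
  have "continuous_on {a..b} (\<lambda>s. F a + integral {a..s} f)"
    by (intro continuous_intros indefinite_integral_continuous_1 primitive_on_integrable[OF assms])
  then show ?thesis
    by (rule continuous_on_eq) (rule primitive_onD[OF assms, symmetric])
qed

lemma primitive_on_norm:
  assumes "f absolutely_integrable_on {a..b}"
  shows "primitive_on (\<lambda>s. integral {a..s} (\<lambda>x. norm (f x))) (\<lambda>x. norm (f x)) a b"
  using set_integrable_norm[OF assms] by (simp add: primitive_on_def)

lemma primitive_on_norm_le: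
  assumes "primitive_on F f a b" "a \<le> s" "s \<le> t" "t \<le> b"
  shows "norm (F t - F s) \<le> integral {a..t} (\<lambda>x. norm (f x)) - integral {a..s} (\<lambda>x. norm (f x))"
proof -
  have n: "primitive_on (\<lambda>s. integral {a..s} (\<lambda>x. norm (f x))) (\<lambda>x. norm (f x)) a b"
    by (rule primitive_on_norm[OF primitive_on_absint[OF assms(1)]])
  show ?thesis
    using integral_norm_bound_integral[of f "{s..t}" "\<lambda>x. norm (f x)"]
      primitive_on_has_integral[OF assms] primitive_on_has_integral[OF n assms(2-4)]
    by (simp add: has_integral_iff)
qed

lemma primitive_on_subinterval:
  assumes "primitive_on F f a b" "a \<le> c" "d \<le> b"
  shows "primitive_on F f c d"
proof (rule primitive_onI)
  show "f absolutely_integrable_on {c..d}"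
    using assms by (auto intro: set_integrable_subset[OF primitive_on_absint[OF assms(1)]])
qed (use assms in \<open>auto intro!: primitive_on_has_integral\<close>)

lemma primitive_on_linear:
  assumes "primitive_on F f a b" "bounded_linear L"
  shows "primitive_on (\<lambda>s. L (F s)) (\<lambda>s. L (f s)) a b"
proof (rule primitive_onI)
  show "(\<lambda>s. L (f s)) absolutely_integrable_on {a..b}"
    using absolutely_integrable_linear[OF primitive_on_absint[OF assms(1)] assms(2)]
    by (simp add: o_def)
  fix s assume s: "a \<le> s" "s \<le> b"
  show "((\<lambda>s. L (f s)) has_integral L (F s) - L (F a)) {a..s}"
    using has_integral_linear[OF primitive_on_has_integral[OF assms(1) order_refl s] assms(2)]
    by (simp add: o_def linear_diff bounded_linear.linear[OF assms(2)])
qed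

lemma primitive_on_add:
  assumes "primitive_on F f a b" "primitive_on G g a b"
  shows "primitive_on (\<lambda>s. F s + G s) (\<lambda>s. f s + g s) a b"
proof (rule primitive_onI)
  fix s assume s: "a \<le> s" "s \<le> b"
  show "((\<lambda>s. f s + g s) has_integral F s + G s - (F a + G a)) {a..s}"
    using has_integral_add[OF primitive_on_has_integral[OF assms(1) order_refl s]
        primitive_on_has_integral[OF assms(2) order_refl s]]
    by (simp add: algebra_simps)
qed (use assms in \<open>auto intro: set_integral_add(1) primitive_on_absint\<close>)

lemma primitive_on_spike:
  assumes F: "primitive_on F f a b" and N: "negligible N" and eq: "\<And>x. x \<in> {a..b} - N \<Longrightarrow> g x = f x"
  shows "primitive_on F g a b"
proof (rule primitive_onI)
  show "g absolutely_integrable_on {a..b}"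
    using absolutely_integrable_spike[OF primitive_on_absint[OF F] N] eq by auto
  fix s assume s: "a \<le> s" "s \<le> b"
  show "(g has_integral F s - F a) {a..s}"
    by (rule has_integral_spike[OF N _ primitive_on_has_integral[OF F order_refl s]]) (use eq s in auto)
qed

lemma primitive_on_C1:
  fixes F :: "real \<Rightarrow> 'a::euclidean_space"
  assumes "\<And>s. s \<in> {a..b} \<Longrightarrow> (F has_vector_derivative f s) (at s within {a..b})"
    and "continuous_on {a..b} f"
  shows "primitive_on F f a b"
proof (rule primitive_onI)
  show "f absolutely_integrable_on {a..b}"
    by (rule absolutely_integrable_continuous_real) fact
  fix s assume s: "a \<le> s" "s \<le> b"
  show "(f has_integral F s - F a) {a..s}"
    using s by (intro fundamental_theorem_of_calculus)
      (auto intro!: has_vector_derivative_within_subset[OF assms(1)])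
qed

lemma absolutely_integrable_continuous_mult:
  fixes f w :: "real \<Rightarrow> 'a::{euclidean_space, real_normed_algebra}"
  assumes "f absolutely_integrable_on {a..b}" "continuous_on {a..b} w"
  shows "(\<lambda>x. w x * f x) absolutely_integrable_on {a..b}"
proof (rule absolutely_integrable_bounded_measurable_product[OF bilinear_times _ _ _ assms(1)])
  show "w \<in> borel_measurable (lebesgue_on {a..b})"
    by (rule continuous_imp_measurable_on_sets_lebesgue[OF assms(2)]) auto
  show "bounded (w ` {a..b})"
    by (intro compact_imp_bounded compact_continuous_image assms) auto
qed auto

text \<open>Over a short interval the two sides differ by the oscillation of \<open>F\<close> and \<open>G\<close> times the mass of
  the densities, so the defect is negligible after summation over a fine partition.\<close>

lemma primitive_on_mult:
  fixes F G f g :: "real \<Rightarrow> complex"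
  assumes F: "primitive_on F f a b" and G: "primitive_on G g a b"
  shows "primitive_on (\<lambda>s. F s * G s) (\<lambda>s. f s * G s + F s * g s) a b"
proof -
  have cF: "continuous_on {a..b} F" and cG: "continuous_on {a..b} G"
    using F G by (auto intro: primitive_on_continuous)
  let ?h = "\<lambda>s. f s * G s + F s * g s"
  have ai: "?h absolutely_integrable_on {a..b}"
    using absolutely_integrable_continuous_mult[OF primitive_on_absint[OF F] cG]
      absolutely_integrable_continuous_mult[OF primitive_on_absint[OF G] cF]
    by (intro set_integral_add(1)) (auto simp: mult.commute)
  define P where "P = (\<lambda>s. integral {a..s} ?h)"
  have P: "primitive_on P ?h a b"
    using ai by (simp add: primitive_on_def P_def)
  define m where "m = (\<lambda>x. norm (f x) + norm (g x))"
  define M where "M = (\<lambda>s. integral {a..s} (\<lambda>x. norm (f x)) + integral {a..s} (\<lambda>x. norm (g x)))"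
  have M: "primitive_on M m a b"
    unfolding M_def m_def
    by (intro primitive_on_add primitive_on_norm primitive_on_absint[OF F] primitive_on_absint[OF G])
  define H where "H = (\<lambda>s. F s * G s - P s)"
  have "H c = H a" if c: "a \<le> c" "c \<le> b" for c
  proof (rule eq_of_local_small[OF c(1), of H M])
    fix \<epsilon> :: real assume "\<epsilon> > 0"
    have "uniformly_continuous_on {a..b} F" "uniformly_continuous_on {a..b} G"
      by (auto intro: compact_uniformly_continuous cF cG)
    then obtain d1 d2 where d: "d1 > 0" "d2 > 0"
      and F': "\<And>x y. x \<in> {a..b} \<Longrightarrow> y \<in> {a..b} \<Longrightarrow> dist x y < d1 \<Longrightarrow> dist (F x) (F y) < \<epsilon>"
      and G': "\<And>x y. x \<in> {a..b} \<Longrightarrow> y \<in> {a..b} \<Longrightarrow> dist x y < d2 \<Longrightarrow> dist (G x) (G y) < \<epsilon>"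
      using \<open>\<epsilon> > 0\<close> unfolding uniformly_continuous_on_def by metis
    have "norm (H t - H s) \<le> \<epsilon> * (M t - M s)"
      if st: "a \<le> s" "s \<le> t" "t \<le> c" "t - s < min d1 d2" for s t
    proof -
      have tb: "t \<le> b" using st c by simp
      \<comment> \<open>The increment of \<open>F * G\<close> is split with \<open>G\<close> frozen
        at \<open>t\<close> and \<open>F\<close> frozen at \<open>s\<close>; subtracting the
        candidate density leaves only small differences of \<open>F\<close> and \<open>G\<close> as
        coefficients.\<close>
      have "((\<lambda>x. f x * G t + F s * g x - ?h x) has_integral
          ((F t - F s) * G t + F s * (G t - G s) - (P t - P s))) {s..t}"
        by (intro has_integral_diff has_integral_add has_integral_mult_left has_integral_mult_right
            primitive_on_has_integral[OF F] primitive_on_has_integral[OF G]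
            primitive_on_has_integral[OF P] st tb)
      then have 1: "((\<lambda>x. f x * (G t - G x) + (F s - F x) * g x) has_integral (H t - H s)) {s..t}"
        by (simp add: H_def algebra_simps)
      have 2: "((\<lambda>x. \<epsilon> * m x) has_integral \<epsilon> * (M t - M s)) {s..t}"
        by (intro has_integral_mult_right primitive_on_has_integral[OF M] st tb)
      have "norm (integral {s..t} (\<lambda>x. f x * (G t - G x) + (F s - F x) * g x))
          \<le> integral {s..t} (\<lambda>x. \<epsilon> * m x)"
      proof (rule integral_norm_bound_integral)
        fix x assume x: "x \<in> {s..t}"
        have "norm (G t - G x) \<le> \<epsilon>" "norm (F s - F x) \<le> \<epsilon>"
          using G'[of t x] F'[of s x] x st tb by (auto simp: dist_norm intro!: less_imp_le)
        then have "norm (f x) * norm (G t - G x) + norm (F s - F x) * norm (g x)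
            \<le> norm (f x) * \<epsilon> + \<epsilon> * norm (g x)"
          using \<open>\<epsilon> > 0\<close> by (intro add_mono mult_mono) auto
        then show "norm (f x * (G t - G x) + (F s - F x) * g x) \<le> \<epsilon> * m x"
          by (intro order_trans[OF norm_triangle_ineq]) (simp only: norm_mult m_def distrib_left mult.commute)
      qed (use 1 2 in \<open>auto simp: has_integral_iff\<close>)
      then show ?thesis unfolding integral_unique[OF 1] integral_unique[OF 2] .
    qed
    then show "\<exists>\<delta>>0. \<forall>s t. a \<le> s \<longrightarrow> s \<le> t \<longrightarrow> t \<le> c \<longrightarrow> t - s < \<delta> \<longrightarrow>
        norm (H t - H s) \<le> \<epsilon> * (M t - M s)"
      using d by (intro exI[of _ "min d1 d2"]) auto
  qed
  note const = this
  have PP: "P s - P a = F s * G s - F a * G a" if "a \<le> s" "s \<le> b" for s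
    using const[OF that] by (simp add: H_def algebra_simps)
  show ?thesis
  proof (rule primitive_onI[OF ai])
    fix s assume s: "a \<le> s" "s \<le> b"
    show "(?h has_integral F s * G s - F a * G a) {a..s}"
      using primitive_on_has_integral[OF P order_refl s] unfolding PP[OF s] .
  qed
qed

text \<open>Taylor's formula for \<open>exp\<close> at an imaginary argument, where the factor
  \<open>exp |Re z|\<close> of the remainder is 1.\<close>

lemma norm_cis_diff_le: "norm (cis x - cis y - \<i> * (x - y) * cis y) \<le> (x - y)\<^sup>2"
proof -
  let ?z = "\<i> * complex_of_real (x - y)"
  have "cis x = cis y * exp ?z"
    by (simp add: cis_conv_exp flip: exp_add) (simp add: algebra_simps)
  then have "cis x - cis y - \<i> * (x - y) * cis y = cis y * (exp ?z - (\<Sum>k\<le>1. ?z ^ k / fact k))"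
    by (simp add: algebra_simps)
  also have "norm \<dots> \<le> exp \<bar>Re ?z\<bar> * norm ?z ^ Suc 1 / fact 1"
    using Taylor_exp[of ?z 1] by (simp add: norm_mult)
  also have "\<dots> = (x - y)\<^sup>2"
    by (simp add: norm_mult power2_eq_square flip: of_real_diff)
  finally show ?thesis .
qed

text \<open>Linearizing \<open>cis\<close> at \<open>\<phi> s\<close> costs an error quadratic in
  the increment of \<phi>, hence a small multiple of the variation \<open>M\<close>; replacing
  \<open>cis (\<phi> x)\<close> by \<open>cis (\<phi> s)\<close> under the integral costs another.
  Each error takes half of \<epsilon>.\<close>

lemma primitive_on_cis:
  assumes "primitive_on \<phi> \<kappa> a b"
  shows "primitive_on (\<lambda>s. cis (\<phi> s)) (\<lambda>s. \<i> * \<kappa> s * cis (\<phi> s)) a b"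
proof -
  have c: "continuous_on {a..b} \<phi>" using assms by (rule primitive_on_continuous)
  then have cc: "continuous_on {a..b} (\<lambda>s. cis (\<phi> s))" by (intro continuous_intros)
  let ?h = "\<lambda>s. \<i> * \<kappa> s * cis (\<phi> s)"
  have K: "primitive_on (\<lambda>s. complex_of_real (\<phi> s)) (\<lambda>s. complex_of_real (\<kappa> s)) a b"
    by (rule primitive_on_linear[OF assms bounded_linear_of_real])
  have ai: "?h absolutely_integrable_on {a..b}"
    using absolutely_integrable_continuous_mult[OF primitive_on_absint[OF K], of "\<lambda>s. \<i> * cis (\<phi> s)"]
      continuous_on_mult[OF continuous_on_const[of _ \<i>] cc]
    by (simp only: mult_ac)
  define P where "P = (\<lambda>s. integral {a..s} ?h)"
  have P: "primitive_on P ?h a b"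
    using ai by (simp add: primitive_on_def P_def)
  define M where "M = (\<lambda>s. integral {a..s} (\<lambda>x. \<bar>\<kappa> x\<bar>))"
  have M: "primitive_on M (\<lambda>x. \<bar>\<kappa> x\<bar>) a b"
    using primitive_on_norm[OF primitive_on_absint[OF assms]] by (simp add: M_def)
  define H where "H = (\<lambda>s. cis (\<phi> s) - P s)"
  have "H d = H a" if d: "a \<le> d" "d \<le> b" for d
  proof (rule eq_of_local_small[OF d(1), of H M])
    fix \<epsilon> :: real assume "\<epsilon> > 0"
    then have "\<epsilon> / 2 > 0" by simp
    moreover have "uniformly_continuous_on {a..b} \<phi>" "uniformly_continuous_on {a..b} (\<lambda>s. cis (\<phi> s))"
      by (auto intro: compact_uniformly_continuous c cc)
    ultimately obtain d1 d2 where d12: "d1 > 0" "d2 > 0"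
      and F': "\<And>x y. x \<in> {a..b} \<Longrightarrow> y \<in> {a..b} \<Longrightarrow> dist x y < d1 \<Longrightarrow> dist (\<phi> x) (\<phi> y) < \<epsilon> / 2"
      and G': "\<And>x y. x \<in> {a..b} \<Longrightarrow> y \<in> {a..b} \<Longrightarrow> dist x y < d2 \<Longrightarrow> dist (cis (\<phi> x)) (cis (\<phi> y)) < \<epsilon> / 2"
      unfolding uniformly_continuous_on_def by metis
    have "norm (H t - H s) \<le> \<epsilon> * (M t - M s)"
      if st: "a \<le> s" "s \<le> t" "t \<le> d" "t - s < min d1 d2" for s t
    proof -
      have tb: "t \<le> b" using st d by simp
      have le: "\<bar>\<phi> t - \<phi> s\<bar> \<le> M t - M s"
        using primitive_on_norm_le[OF assms st(1,2) tb] by (simp add: M_def)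
      have "((\<lambda>x. \<i> * cis (\<phi> s) * complex_of_real (\<kappa> x) - ?h x) has_integral
          (\<i> * cis (\<phi> s) * (complex_of_real (\<phi> t) - \<phi> s) - (P t - P s))) {s..t}"
        by (intro has_integral_diff has_integral_mult_right
            primitive_on_has_integral[OF K] primitive_on_has_integral[OF P] st tb)
      then have 1: "((\<lambda>x. \<i> * \<kappa> x * (cis (\<phi> s) - cis (\<phi> x))) has_integral
          (\<i> * cis (\<phi> s) * (complex_of_real (\<phi> t) - \<phi> s) - (P t - P s))) {s..t}"
        by (simp add: algebra_simps)
      have 2: "((\<lambda>x. \<epsilon> / 2 * \<bar>\<kappa> x\<bar>) has_integral \<epsilon> / 2 * (M t - M s)) {s..t}"
        by (intro has_integral_mult_right primitive_on_has_integral[OF M] st tb)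
      have "norm (integral {s..t} (\<lambda>x. \<i> * \<kappa> x * (cis (\<phi> s) - cis (\<phi> x))))
          \<le> integral {s..t} (\<lambda>x. \<epsilon> / 2 * \<bar>\<kappa> x\<bar>)"
      proof (rule integral_norm_bound_integral)
        fix x assume x: "x \<in> {s..t}"
        have "norm (cis (\<phi> s) - cis (\<phi> x)) \<le> \<epsilon> / 2"
          using G'[of s x] x st tb by (auto simp: dist_norm intro!: less_imp_le)
        then show "norm (\<i> * \<kappa> x * (cis (\<phi> s) - cis (\<phi> x))) \<le> \<epsilon> / 2 * \<bar>\<kappa> x\<bar>"
          using mult_right_mono[of "norm (cis (\<phi> s) - cis (\<phi> x))" "\<epsilon> / 2" "\<bar>\<kappa> x\<bar>"]
          by (simp add: norm_mult mult_ac)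
      qed (use 1 2 in \<open>auto simp: has_integral_iff\<close>)
      then have 3: "norm (\<i> * cis (\<phi> s) * (complex_of_real (\<phi> t) - \<phi> s) - (P t - P s)) \<le> \<epsilon> / 2 * (M t - M s)"
        unfolding integral_unique[OF 1] integral_unique[OF 2] .
      have "\<bar>\<phi> t - \<phi> s\<bar> \<le> \<epsilon> / 2"
        using F'[of t s] st tb by (auto simp: dist_norm intro!: less_imp_le)
      then have "(\<phi> t - \<phi> s)\<^sup>2 \<le> \<epsilon> / 2 * (M t - M s)"
        using le mult_mono[of "\<bar>\<phi> t - \<phi> s\<bar>" "\<epsilon> / 2" "\<bar>\<phi> t - \<phi> s\<bar>" "M t - M s"] \<open>\<epsilon> > 0\<close>
        by (simp add: power2_eq_square)
      then have 4: "norm (cis (\<phi> t) - cis (\<phi> s) - \<i> * (\<phi> t - \<phi> s) * cis (\<phi> s)) \<le> \<epsilon> / 2 * (M t - M s)"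
        using norm_cis_diff_le[of "\<phi> t" "\<phi> s"] by linarith
      have "H t - H s = (\<i> * cis (\<phi> s) * (complex_of_real (\<phi> t) - \<phi> s) - (P t - P s)) +
          (cis (\<phi> t) - cis (\<phi> s) - \<i> * (\<phi> t - \<phi> s) * cis (\<phi> s))"
        by (simp add: H_def algebra_simps)
      then show ?thesis
        using 3 4 by (smt (verit) norm_triangle_ineq field_sum_of_halves distrib_right)
    qed
    then show "\<exists>\<delta>>0. \<forall>s t. a \<le> s \<longrightarrow> s \<le> t \<longrightarrow> t \<le> d \<longrightarrow> t - s < \<delta> \<longrightarrow>
        norm (H t - H s) \<le> \<epsilon> * (M t - M s)"
      using d12 by (intro exI[of _ "min d1 d2"]) auto
  qed
  note const = this
  have PP: "P s - P a = cis (\<phi> s) - cis (\<phi> a)" if "a \<le> s" "s \<le> b" for s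
    using const[OF that] by (simp add: H_def algebra_simps)
  show ?thesis
  proof (rule primitive_onI[OF ai])
    fix s assume s: "a \<le> s" "s \<le> b"
    show "(?h has_integral cis (\<phi> s) - cis (\<phi> a)) {a..s}"
      using primitive_on_has_integral[OF P order_refl s] unfolding PP[OF s] .
  qed
qed

text \<open>By Henstock's lemma the Riemann sums of the indicator of \<open>{f < - 1 / (n + 1)}\<close> are small,
  since on every tagged interval contributing to them \<open>f x\<close> and the integral have opposite sign.\<close>

lemma negligible_neg_of_mono:
  fixes F f :: "real \<Rightarrow> real"
  assumes F: "primitive_on F f a b" and mono: "\<And>s t. a \<le> s \<Longrightarrow> s \<le> t \<Longrightarrow> t \<le> b \<Longrightarrow> F s \<le> F t"
  shows "negligible {x\<in>{a..b}. f x < 0}"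
proof -
  define E where "E = (\<lambda>n::nat. {x\<in>{a..b}. f x < - 1 / (real n + 1)})"
  have negE: "negligible (E n)" for n
  proof -
    have "((indicator (E n) :: real \<Rightarrow> real) has_integral 0) (cbox a b)"
      unfolding has_integral
    proof (intro allI impI)
      fix e :: real assume "e > 0"
      then have e': "e / (real n + 1) > 0" by simp
      have fi: "f integrable_on cbox a b" using primitive_on_integrable[OF F] by simp
      obtain g where g: "gauge g" and hen: "\<And>p. \<lbrakk>p tagged_partial_division_of (cbox a b); g fine p\<rbrakk> \<Longrightarrow>
             sum (\<lambda>(x,k). norm(measure lborel k *\<^sub>R f x - integral k f)) p < e / (real n + 1)"
        by (rule Henstock_lemma[OF fi e'], rule that)
      have "norm ((\<Sum>(x, k)\<in>D. measure lborel k *\<^sub>R (indicator (E n) x :: real)) - 0) < e"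
        if D: "D tagged_division_of cbox a b" "g fine D" for D
      proof -
        define p where "p = {(x,K) \<in> D. x \<in> E n}"
        have fin: "finite D" using D(1) by auto
        have pD: "p \<subseteq> D" by (auto simp: p_def)
        have p: "p tagged_partial_division_of cbox a b" "g fine p"
          using tagged_partial_division_subset[OF _ pD] D(1) fine_subset[OF pD D(2)]
          by (simp_all add: tagged_division_of_def)
        have "(\<Sum>(x, k)\<in>D. measure lborel k *\<^sub>R (indicator (E n) x :: real)) = (\<Sum>(x, k)\<in>p. measure lborel k)"
          by (rule sum.mono_neutral_cong_right[OF fin pD]) (auto simp: p_def indicator_def)
        also have "\<dots> \<le> (\<Sum>(x, k)\<in>p. (real n + 1) * norm (measure lborel k *\<^sub>R f x - integral k f))"
        proof (rule sum_mono, clarify)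
          fix x K assume xK: "(x, K) \<in> p"
          then obtain u v where K: "K = cbox u v" and sub: "K \<subseteq> {a..b}" and "x \<in> K"
            using p(1) unfolding tagged_partial_division_of_def by (metis box_real(2))
          then have "u \<le> v" by auto
          then have uv: "a \<le> u" "v \<le> b" using sub K by auto
          have "integral K f = F v - F u"
            using primitive_on_integral[OF F uv(1) \<open>u \<le> v\<close> uv(2)] K by simp
          then have "integral K f \<ge> 0" using mono uv \<open>u \<le> v\<close> by simp
          moreover have "f x < - 1 / (real n + 1)" using xK by (simp add: p_def E_def)
          then have "f x * (real n + 1) \<le> - 1" by (simp add: field_simps)
          then have "measure lborel K * (f x * (real n + 1)) \<le> measure lborel K * (- 1)"
            by (intro mult_left_mono) auto
          moreover have "(real n + 1) * norm (measure lborel K *\<^sub>R f x - integral K f)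
             \<ge> (real n + 1) * (integral K f - measure lborel K * f x)"
            by (intro mult_left_mono) auto
          ultimately show "measure lborel K \<le> (real n + 1) * norm (measure lborel K *\<^sub>R f x - integral K f)"
            by (smt (verit, best) mult.assoc mult.commute mult_nonneg_nonneg of_nat_0_le_iff right_diff_distrib)
        qed
        also have "\<dots> = (real n + 1) * (\<Sum>(x, k)\<in>p. norm (measure lborel k *\<^sub>R f x - integral k f))"
          by (simp add: sum_distrib_left case_prod_unfold)
        also have "\<dots> < (real n + 1) * (e / (real n + 1))"
          by (intro mult_strict_left_mono hen p) auto
        also have "\<dots> = e" by simp
        finally have "(\<Sum>(x, k)\<in>D. measure lborel k *\<^sub>R (indicator (E n) x :: real)) < e" .
        moreover have "0 \<le> (\<Sum>(x, k)\<in>D. measure lborel k *\<^sub>R (indicator (E n) x :: real))"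
          by (intro sum_nonneg) auto
        ultimately show ?thesis by simp
      qed
      then show "\<exists>\<gamma>. gauge \<gamma> \<and> (\<forall>D. D tagged_division_of cbox a b \<and> \<gamma> fine D \<longrightarrow>
          norm ((\<Sum>(x, k)\<in>D. measure lborel k *\<^sub>R (indicator (E n) x :: real)) - 0) < e)"
        using g by blast
    qed
    then have "((indicator (E n) :: real \<Rightarrow> real) has_integral 0) UNIV"
      by (rule has_integral_on_superset) (auto simp: E_def)
    then show ?thesis by (simp add: negligible_UNIV)
  qed
  have "{x\<in>{a..b}. f x < 0} \<subseteq> (\<Union>n. E n)"
  proof
    fix x assume x: "x \<in> {x\<in>{a..b}. f x < 0}"
    then obtain n where "1 / real (Suc n) < - f x" using nat_approx_posE[of "- f x"] by auto
    then have "x \<in> E n" using x by (auto simp: E_def add.commute)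
    then show "x \<in> (\<Union>n. E n)" by blast
  qed
  then show ?thesis
    using negE by (meson negligible_Union_nat negligible_subset)
qed

text \<open>All integrals of \<open>f\<close> over initial intervals vanish, so the zero function is
  a primitive of \<open>- f\<close>; being nondecreasing, it forces \<open>- f\<close> to be
  nonnegative almost everywhere.\<close>

lemma negligible_of_has_integral_0:
  fixes f :: "real \<Rightarrow> real"
  assumes f: "(f has_integral 0) {a..b}" and ge: "\<And>s. s \<in> {a..b} \<Longrightarrow> f s \<ge> 0"
  shows "negligible {s\<in>{a..b}. f s \<noteq> 0}"
proof -
  have "f integrable_on {a..b}" using f by blast
  then have ai: "f absolutely_integrable_on {a..b}"
    using ge by (intro nonnegative_absolutely_integrable_1) auto
  have fi: "f integrable_on {a..s}" if "s \<le> b" for s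
    using \<open>f integrable_on {a..b}\<close> that by (auto elim: integrable_on_subinterval)
  have z: "integral {a..s} f = 0" if s: "a \<le> s" "s \<le> b" for s
  proof (rule antisym)
    have "integral {a..s} f \<le> integral {a..b} f"
      using s ge fi by (intro integral_subset_le) auto
    then show "integral {a..s} f \<le> 0" using integral_unique[OF f] by simp
    show "0 \<le> integral {a..s} f" using s ge fi by (intro integral_nonneg) auto
  qed
  have "primitive_on (\<lambda>_. 0) (\<lambda>s. - f s) a b"
  proof (rule primitive_onI)
    show "(\<lambda>s. - f s) absolutely_integrable_on {a..b}" 
      using absolutely_integrable_linear[OF ai bounded_linear_minus[OF bounded_linear_ident]] by (simp add: o_def)
    fix s assume s: "a \<le> s" "s \<le> b"
    show "((\<lambda>s. - f s) has_integral 0 - 0) {a..s}"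
      using has_integral_neg[OF integrable_integral[OF fi[OF s(2)]]] z[OF s] by simp
  qed
  then have "negligible {s\<in>{a..b}. - f s < 0}" by (rule negligible_neg_of_mono) simp
  then show ?thesis by (rule negligible_subset) (use ge in force)
qed

text \<open>A constant is nondecreasing under each of the functionals Re, - Re, Im and - Im, so none
  of them is negative on a set of positive measure. This turns identities between primitives into
  identities between densities.\<close>

lemma negligible_nonzero_of_const:
  fixes F f :: "real \<Rightarrow> complex"
  assumes F: "primitive_on F f a b" and const: "\<And>s. a \<le> s \<Longrightarrow> s \<le> b \<Longrightarrow> F s = F a"
  shows "negligible {x\<in>{a..b}. f x \<noteq> 0}"
proof -
  have N: "negligible {x\<in>{a..b}. L (f x) < 0}" if "bounded_linear L" for L :: "complex \<Rightarrow> real"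
  proof (rule negligible_neg_of_mono[OF primitive_on_linear[OF F that]])
    fix s t assume st: "a \<le> s" "s \<le> t" "t \<le> b"
    then have "F s = F t" using const[of s] const[of t] by simp
    then show "L (F s) \<le> L (F t)" by simp
  qed
  have "{x\<in>{a..b}. f x \<noteq> 0} \<subseteq> {x\<in>{a..b}. Re (f x) < 0} \<union> {x\<in>{a..b}. - Re (f x) < 0} \<union>
     {x\<in>{a..b}. Im (f x) < 0} \<union> {x\<in>{a..b}. - Im (f x) < 0}"
    by (auto simp: complex_eq_iff)
  moreover have "negligible \<dots>"
    by (intro negligible_Un N bounded_linear_Re bounded_linear_Im bounded_linear_minus)
  ultimately show ?thesis by (rule negligible_subset[rotated])
qed

lemma primitive_on_zero_const:
  assumes "primitive_on F f a b" "negligible N" "\<And>x. x \<in> {a..b} - N \<Longrightarrow> f x = 0"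
    and "s \<in> {a..b}"
  shows "F s = F a"
proof -
  have "primitive_on F (\<lambda>x. 0) a b"
    by (rule primitive_on_spike[OF assms(1,2)]) (use assms(3) in auto)
  from primitive_onD[OF this assms(4)] show ?thesis by simp
qed

section \<open>Arcs turning by a half circle\<close>

lemma powr_ge_tangent:
  fixes p x y :: real
  assumes p: "p > 1" and x: "x \<ge> 0" and y: "y > 0"
  shows "p * x * y powr (p - 1) - (p - 1) * y powr p \<le> x powr p"
    and "x powr p = p * x * y powr (p - 1) - (p - 1) * y powr p \<Longrightarrow> x = y"
proof -
  \<comment> \<open>Strictness away from the point of tangency serves both claims. The case
    \<open>x = 0\<close> is separate because the derivative rule for \<open>powr\<close> asks for a
    positive base.\<close>
  have less: "p * x * y powr (p - 1) - (p - 1) * y powr p < x powr p" if xy: "x \<noteq> y"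
  proof -
    consider "x = 0" | "0 < x" "x < y" | "y < x" using x xy by fastforce
    then show ?thesis
    proof cases
      case 1 then show ?thesis using p y by simp
    next
      case 2
      have "\<And>t. x \<le> t \<Longrightarrow> t \<le> y \<Longrightarrow> ((\<lambda>t. t powr p) has_real_derivative p * t powr (p - 1)) (at t)"
        using 2 by (intro has_real_derivative_powr) auto
      from MVT2[OF \<open>x < y\<close> this] obtain t where t: "x < t" "t < y"
        "y powr p - x powr p = (y - x) * (p * t powr (p - 1))" by auto
      have "t powr (p - 1) < y powr (p - 1)" using t 2 p by (intro powr_less_mono2) auto
      then have "(y - x) * p * t powr (p - 1) < (y - x) * p * y powr (p - 1)"
        using 2 p by (intro mult_strict_left_mono) auto
      moreover have "y * y powr (p - 1) = y powr p" using y by (simp add: powr_diff)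
      ultimately show ?thesis using t(3) by (simp add: algebra_simps)
    next
      case 3
      have "\<And>t. y \<le> t \<Longrightarrow> t \<le> x \<Longrightarrow> ((\<lambda>t. t powr p) has_real_derivative p * t powr (p - 1)) (at t)"
        using y by (intro has_real_derivative_powr) auto
      from MVT2[OF \<open>y < x\<close> this] obtain t where t: "y < t" "t < x"
        "x powr p - y powr p = (x - y) * (p * t powr (p - 1))" by auto
      have "y powr (p - 1) < t powr (p - 1)" using t y p by (intro powr_less_mono2) auto
      then have "(x - y) * p * y powr (p - 1) < (x - y) * p * t powr (p - 1)"
        using 3 p by (intro mult_strict_left_mono) auto
      moreover have "y * y powr (p - 1) = y powr p" using y by (simp add: powr_diff)
      ultimately show ?thesis using t(3) by (simp add: algebra_simps)
    qed
  qed
  show "p * x * y powr (p - 1) - (p - 1) * y powr p \<le> x powr p"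
  proof (cases "x = y")
    case True
    have "y * y powr (p - 1) = y powr p" using y by (simp add: powr_diff)
    then show ?thesis using True by (simp add: algebra_simps)
  qed (use less in auto)
  show "x powr p = p * x * y powr (p - 1) - (p - 1) * y powr p \<Longrightarrow> x = y"
    using less by fastforce
qed

text \<open>The difference of the two sides is the square of the difference of the powers with
  exponent \<open>\<beta> / 2\<close>. It is applied with exponent \<open>1 - p\<close> to the two
  radii of one arc and with \<open>(1 - p) / 2\<close> to the scaled areas of the two arcs.\<close>

lemma powr_add_ge_geometric_mean:
  fixes x y \<beta> :: real
  assumes x: "x > 0" and y: "y > 0" and \<beta>: "\<beta> < 0"
  shows "2 * (x * y) powr (\<beta> / 2) \<le> x powr \<beta> + y powr \<beta>"
    and "x powr \<beta> + y powr \<beta> = 2 * (x * y) powr (\<beta> / 2) \<Longrightarrow> x = y"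
proof -
  define u v where "u = x powr (\<beta> / 2)" and "v = y powr (\<beta> / 2)"
  have uv: "x powr \<beta> = u\<^sup>2" "y powr \<beta> = v\<^sup>2" "(x * y) powr (\<beta> / 2) = u * v"
    using x y by (simp_all add: u_def v_def power2_eq_square powr_mult flip: powr_add)
  have eq: "x powr \<beta> + y powr \<beta> - 2 * (x * y) powr (\<beta> / 2) = (u - v)\<^sup>2"
    unfolding uv by (simp add: power2_eq_square algebra_simps)
  show "2 * (x * y) powr (\<beta> / 2) \<le> x powr \<beta> + y powr \<beta>"
    using eq zero_le_power2[of "u - v"] by linarith
  show "x = y" if "x powr \<beta> + y powr \<beta> = 2 * (x * y) powr (\<beta> / 2)"
  proof -
    have "u = v" using eq that by simp
    then have "u powr (2 / \<beta>) = v powr (2 / \<beta>)" by simp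
    then show ?thesis using x y \<beta> by (simp add: u_def v_def powr_powr)
  qed
qed

lemma has_integral_semicircle:
  assumes "c \<ge> (0::real)"
  shows "((\<lambda>u. sqrt (c\<^sup>2 - u\<^sup>2)) has_integral pi * c\<^sup>2 / 2) {-c..c}"
proof (cases "c = 0")
  case False
  then have c: "c > 0" using assms by simp
  define G where "G = (\<lambda>u. (u * sqrt (c\<^sup>2 - u\<^sup>2) + c\<^sup>2 * arcsin (u / c)) / 2)"
  have "((\<lambda>u. sqrt (c\<^sup>2 - u\<^sup>2)) has_integral (G c - G (- c))) {-c..c}"
  \<comment> \<open>\<open>arcsin (u / c)\<close> is not differentiable at the ends, hence the
    version that asks for derivatives only inside.\<close>
  proof (rule fundamental_theorem_of_calculus_interior)
    show "continuous_on {-c..c} G"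
      unfolding G_def using c by (auto intro!: continuous_intros simp: field_simps)
    fix u assume u: "u \<in> {-c<..<c}"
    define q where "q = sqrt (c\<^sup>2 - u\<^sup>2)"
    have pos: "c\<^sup>2 - u\<^sup>2 > 0"
      using mult_pos_pos[of "c - u" "c + u"] u by (simp add: power2_eq_square algebra_simps)
    then have q: "q > 0" "q\<^sup>2 = c\<^sup>2 - u\<^sup>2" by (simp_all add: q_def)
    have "1 - (u / c)\<^sup>2 = (q / c)\<^sup>2" using c q(2) by (simp add: field_simps)
    then have s: "sqrt (1 - (u / c)\<^sup>2) = q / c" using c q(1) by simp
    have uc: "- 1 < u / c" "u / c < 1" using u c by (auto simp: field_simps)
    have "(G has_real_derivative q) (at u)"
      unfolding G_def
      using pos uc c q by (auto intro!: derivative_eq_intros simp: s simp flip: q_def)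
        (simp add: field_simps power2_eq_square)
    then show "(G has_vector_derivative sqrt (c\<^sup>2 - u\<^sup>2)) (at u)"
      by (simp add: has_real_derivative_iff_has_vector_derivative q_def)
  qed (use c in auto)
  moreover have "G c - G (- c) = pi * c\<^sup>2 / 2"
    using c by (simp add: G_def arcsin_minus field_simps)
  ultimately show ?thesis by simp
next
  case True
  then show ?thesis using has_integral_refl(2)[of _ "0::real"] by simp
qed

lemma le_of_deriv_nonneg:
  fixes F F' :: "real \<Rightarrow> real"
  assumes "s \<le> t" "{s..t} \<subseteq> S"
    and "\<And>x. x \<in> S \<Longrightarrow> (F has_real_derivative F' x) (at x within S)"
    and "\<And>x. x \<in> {s..t} \<Longrightarrow> F' x \<ge> 0"
  shows "F s \<le> F t"
proof -
  have "(F' has_integral (F t - F s)) {s..t}"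
  proof (rule fundamental_theorem_of_calculus[OF assms(1)])
    fix x assume "x \<in> {s..t}"
    then have "(F has_real_derivative F' x) (at x within {s..t})"
      using assms(2,3) by (blast intro: has_field_derivative_subset)
    then show "(F has_vector_derivative F' x) (at x within {s..t})"
      by (simp add: has_real_derivative_iff_has_vector_derivative)
  qed
  from has_integral_nonneg[OF this assms(4)] show ?thesis by simp
qed

section \<open>Support function, area and energy of a half turn arc\<close>

locale half_turn_arc =
  fixes \<gamma> T :: "real \<Rightarrow> complex" and \<phi> \<kappa> :: "real \<Rightarrow> real" and a b :: real
  assumes ab: "a < b"
    and deriv: "\<And>s. s \<in> {a..b} \<Longrightarrow> (\<gamma> has_vector_derivative T s) (at s within {a..b})"
    and T: "\<And>s. s \<in> {a..b} \<Longrightarrow> T s = cis (\<phi> s)"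
    and \<phi>: "primitive_on \<phi> \<kappa> a b"
    and \<kappa>: "\<And>s. s \<in> {a..b} \<Longrightarrow> \<kappa> s \<ge> 0"
    and turn: "\<phi> b = \<phi> a + pi"
begin

definition m :: complex where "m = (\<gamma> a + \<gamma> b) / 2"

text \<open>The support function about \<open>m\<close> in terms of arc length: the inner product of
  \<open>\<gamma> s - m\<close> with the outer unit normal \<open>- \<i> * T s\<close>.\<close>

definition h :: "real \<Rightarrow> real" where "h s = Im (cnj (\<gamma> s - m) * T s)"

definition area :: real where "area = integral {a..b} h / 2"

lemma \<phi>_mono: "a \<le> s \<Longrightarrow> s \<le> t \<Longrightarrow> t \<le> b \<Longrightarrow> \<phi> s \<le> \<phi> t"
  using has_integral_nonneg[OF primitive_on_has_integral[OF \<phi>, of s t]] \<kappa> by force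

lemma continuous_T: "continuous_on {a..b} T"
proof -
  have "continuous_on {a..b} (\<lambda>s. cis (\<phi> s))"
    by (intro continuous_intros primitive_on_continuous[OF \<phi>])
  then show ?thesis by (rule continuous_on_eq) (simp add: T)
qed

lemma continuous_\<gamma>: "continuous_on {a..b} \<gamma>"
  using deriv by (rule continuous_on_vector_derivative)

lemma continuous_h: "continuous_on {a..b} h"
  unfolding h_def by (intro continuous_intros continuous_T continuous_\<gamma>)

lemma h_has_integral: "(h has_integral 2 * area) {a..b}"
  using integrable_integral[OF integrable_continuous_real[OF continuous_h]] by (simp add: area_def)

text \<open>The point reflection in \<open>m\<close> carries the start of the arc with its tangent
  to the end. Products of two such quantities therefore agree at both ends, which removes the
  boundary terms in the partial integrations below.\<close>

lemma ends: "\<gamma> b - m = - (\<gamma> a - m)" "cis (\<phi> b) = - cis (\<phi> a)"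
  by (simp_all add: m_def turn field_simps flip: cis_mult)

text \<open>Bonnesen's inequality at the support value \<open>h s\<^sub>0\<close>. The arc, followed by its point reflection in
  the midpoint of the chord, is traversed starting at \<open>s\<^sub>0\<close>; as in E. Schmidt's proof of the
  isoperimetric inequality it is compared with the half circle of radius \<open>h s\<^sub>0\<close> lying in the same strip.\<close>

lemma bonnesen:
  assumes s0: "s\<^sub>0 \<in> {a..b}"
  shows "h s\<^sub>0 \<ge> 0" "area + pi * (h s\<^sub>0)\<^sup>2 / 2 \<le> (b - a) * h s\<^sub>0"
proof -
  define c where "c = h s\<^sub>0"
  \<comment> \<open>Coordinates with origin \<open>m\<close> in which the tangent at
    \<open>s\<^sub>0\<close> points along the positive real axis. The point of parameter
    \<open>s\<^sub>0\<close> then has height \<open>- c\<close>.\<close>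
  define z where "z = (\<lambda>t. cnj (T s\<^sub>0) * (\<gamma> t - m))"
  define X Y where "X = (\<lambda>t. Re (z t))" and "Y = (\<lambda>t. Im (z t))"
  define X' Y' where "X' = (\<lambda>t. cos (\<phi> t - \<phi> s\<^sub>0))" and "Y' = (\<lambda>t. sin (\<phi> t - \<phi> s\<^sub>0))"
  have w: "cnj (T s\<^sub>0) * T t = Complex (X' t) (Y' t)" if "t \<in> {a..b}" for t
    using s0 that by (simp add: T X'_def Y'_def cis_cnj cis_mult) (simp add: cis.code)
  have dz: "(z has_vector_derivative Complex (X' t) (Y' t)) (at t within {a..b})" if "t \<in> {a..b}" for t
    unfolding z_def w[OF that, symmetric] using deriv[OF that] by (auto intro!: derivative_eq_intros)
  have dX: "(X has_real_derivative X' t) (at t within {a..b})"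
    and dY: "(Y has_real_derivative Y' t) (at t within {a..b})" if "t \<in> {a..b}" for t
    using bounded_linear.has_vector_derivative[OF bounded_linear_Re dz[OF that]]
      bounded_linear.has_vector_derivative[OF bounded_linear_Im dz[OF that]]
    by (simp_all add: X_def Y_def has_real_derivative_iff_has_vector_derivative)
  have Ys0: "Y s\<^sub>0 = - c" by (simp add: Y_def z_def c_def h_def algebra_simps)
  have Yab: "Y b = - Y a" "X b = - X a"
    unfolding X_def Y_def z_def ends(1) by (simp_all add: algebra_simps)
  \<comment> \<open>The height falls before \<open>s\<^sub>0\<close> and rises afterwards, since the
    angle differs from \<open>\<phi> s\<^sub>0\<close> by at most \<pi>. So the arc and its
    reflection lie in the strip of heights between \<open>- c\<close> and \<open>c\<close>.\<close>
  have Yup: "Y s \<le> Y t" if "s\<^sub>0 \<le> s" "s \<le> t" "t \<le> b" for s t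
  proof (rule le_of_deriv_nonneg[OF \<open>s \<le> t\<close> _ dY])
    fix x assume "x \<in> {s..t}"
    then have "\<phi> s\<^sub>0 \<le> \<phi> x" "\<phi> x \<le> \<phi> b" "\<phi> a \<le> \<phi> s\<^sub>0" using that s0 by (auto intro: \<phi>_mono)
    then show "0 \<le> Y' x" using turn by (auto simp: Y'_def intro!: sin_ge_zero)
  qed (use that s0 in auto)
  have Ydown: "Y t \<le> Y s" if "a \<le> s" "s \<le> t" "t \<le> s\<^sub>0" for s t
  proof -
    have "- Y s \<le> - Y t"
    proof (rule le_of_deriv_nonneg[OF \<open>s \<le> t\<close> _ DERIV_minus[OF dY]])
      fix x assume "x \<in> {s..t}"
      then have "\<phi> x \<le> \<phi> s\<^sub>0" "\<phi> s\<^sub>0 \<le> \<phi> b" "\<phi> a \<le> \<phi> x" using that s0 by (auto intro: \<phi>_mono)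
      then have "sin (\<phi> s\<^sub>0 - \<phi> x) \<ge> 0" using turn by (auto intro!: sin_ge_zero)
      then show "0 \<le> - Y' x" by (simp add: Y'_def sin_diff mult.commute)
    qed (use that s0 in auto)
    then show ?thesis by simp
  qed
  have Yb: "\<bar>Y b\<bar> \<le> c"
    using Yup[of s\<^sub>0 b] Ydown[of a s\<^sub>0] s0 Ys0 Yab by auto
  have Yc: "\<bar>Y t\<bar> \<le> c" if "t \<in> {a..b}" for t
    using Yup[of s\<^sub>0 t] Yup[of t b] Ydown[of a t] Ydown[of t s\<^sub>0] s0 Ys0 Yab Yb that by (cases "t \<le> s\<^sub>0") auto
  show "h s\<^sub>0 \<ge> 0" using Yb by (simp add: c_def)
  \<comment> \<open>\<open>f u\<close> is the abscissa at height \<open>u\<close> of the half circle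
    of radius \<open>c\<close> used for comparison.\<close>
  define f where "f = (\<lambda>u. sqrt (c\<^sup>2 - u\<^sup>2))"
  have cf: "continuous_on S f" for S unfolding f_def by (intro continuous_intros)
  have I1: "((\<lambda>t. Y' t *\<^sub>R f (Y t)) has_integral (integral {Y s\<^sub>0..Y b} f)) {s\<^sub>0..b}"
  proof (rule has_integral_substitution[where c = "-c" and d = c])
    show "Y ` {s\<^sub>0..b} \<subseteq> {-c..c}" 
    proof (rule image_subsetI)
      fix t assume "t \<in> {s\<^sub>0..b}"
      then have "\<bar>Y t\<bar> \<le> c" using Yc s0 by simp
      then show "Y t \<in> {-c..c}" by auto
    qed
    show "(Y has_real_derivative Y' t) (at t within {s\<^sub>0..b})" if "t \<in> {s\<^sub>0..b}" for t
      using dY[of t] s0 that by (auto intro: has_field_derivative_subset)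
  qed (use s0 Yup[of s\<^sub>0 b] cf in auto)
  have I2: "((\<lambda>t. (- Y' t) *\<^sub>R f (- Y t)) has_integral (integral {- Y a..- Y s\<^sub>0} f)) {a..s\<^sub>0}"
  proof (rule has_integral_substitution[where c = "-c" and d = c])
    show "(\<lambda>t. - Y t) ` {a..s\<^sub>0} \<subseteq> {-c..c}" 
    proof (rule image_subsetI)
      fix t assume "t \<in> {a..s\<^sub>0}"
      then have "\<bar>Y t\<bar> \<le> c" using Yc s0 by simp
      then show "- Y t \<in> {-c..c}" by auto
    qed
    show "((\<lambda>t. - Y t) has_real_derivative - Y' t) (at t within {a..s\<^sub>0})" if "t \<in> {a..s\<^sub>0}" for t
      using dY[of t] s0 that by (auto intro!: derivative_intros intro: has_field_derivative_subset)
  qed (use s0 Ydown[of a s\<^sub>0] cf in auto)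
  \<comment> \<open>The piece after \<open>s\<^sub>0\<close> rises from \<open>- c\<close> to
    \<open>Y b\<close>, and the reflected piece before it goes on from \<open>- Y a = Y b\<close> to
    \<open>c\<close>; together they sweep the half disc once.\<close>
  have "integral {- c..Y b} f + integral {Y b..c} f = integral {-c..c} f"
    using Yb cf by (intro Henstock_Kurzweil_Integration.integral_combine integrable_continuous_real) auto
  then have I12: "integral {Y s\<^sub>0..Y b} f + integral {- Y a..- Y s\<^sub>0} f = pi * c\<^sup>2 / 2"
    using has_integral_semicircle[of c] Yb Yab Ys0 by (simp add: f_def has_integral_iff)
  \<comment> \<open>The derivative of \<open>X * Y\<close> integrates to zero by the reflection, so
    half of it may be subtracted to replace the symmetric area form by
    \<open>- Y * X'\<close>.\<close>
  have "((\<lambda>t. X' t * Y t + Y' t * X t) has_integral (X b * Y b - X a * Y a)) {a..b}"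
    using ab dX dY by (intro fundamental_theorem_of_calculus)
      (auto intro!: DERIV_mult simp flip: has_real_derivative_iff_has_vector_derivative)
  then have "((\<lambda>t. X' t * Y t + Y' t * X t) has_integral 0) {a..b}" by (simp add: Yab)
  from has_integral_mult_right[OF has_integral_diff[OF h_has_integral this], of "1/2"]
  have "((\<lambda>t. 1 / 2 * (h t - (X' t * Y t + Y' t * X t))) has_integral area) {a..b}" by simp
  moreover have "1 / 2 * (h t - (X' t * Y t + Y' t * X t)) = - Y t * X' t" if "t \<in> {a..b}" for t
  proof -
    have "cnj (z t) * (cnj (T s\<^sub>0) * T t) = (T s\<^sub>0 * cnj (T s\<^sub>0)) * (cnj (\<gamma> t - m) * T t)"
      by (simp add: z_def mult_ac)
    also have "T s\<^sub>0 * cnj (T s\<^sub>0) = 1" using s0 by (simp add: T cis_cnj cis_mult)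
    finally have "cnj (\<gamma> t - m) * T t = cnj (z t) * Complex (X' t) (Y' t)" using w[OF that] by simp
    then have "h t = X t * Y' t - Y t * X' t" by (simp add: h_def X_def Y_def)
    then show ?thesis by (simp add: algebra_simps)
  qed
  ultimately have I3: "((\<lambda>t. - Y t * X' t) has_integral area) {a..b}"
    by (rule has_integral_eq[rotated])
  then obtain i1 i2 where I4: "((\<lambda>t. - Y t * X' t) has_integral i1) {a..s\<^sub>0}"
    "((\<lambda>t. - Y t * X' t) has_integral i2) {s\<^sub>0..b}"
    using s0 unfolding has_integral_integrable_integral
    by (meson atLeastAtMost_iff integrable_on_subinterval integrable_on_subinterval subset_refl
        atLeastatMost_subset_iff order_refl)
  then have i12: "i1 + i2 = area"
    using has_integral_combine[OF _ _ I4] s0 has_integral_unique[OF _ I3] by auto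
  \<comment> \<open>Cauchy-Schwarz through Lagrange's identity. Schmidt's point is that the mixed
    vector, with its abscissa from the circle and its ordinate from the arc, has length
    \<open>c\<close>, so against the unit tangent it gives at most \<open>c\<close> per unit of arc
    length.\<close>
  have cs: "p * x - y * q \<le> c" if "x\<^sup>2 + y\<^sup>2 = c\<^sup>2" "p\<^sup>2 + q\<^sup>2 = 1" for p q x y :: real
  proof -
    have "(p * x - y * q)\<^sup>2 + (p * y + q * x)\<^sup>2 = (p\<^sup>2 + q\<^sup>2) * (x\<^sup>2 + y\<^sup>2)"
      by (simp add: power2_eq_square algebra_simps)
    also have "\<dots> = c\<^sup>2" by (simp add: that)
    finally have "(p * x - y * q)\<^sup>2 \<le> c\<^sup>2" using zero_le_power2[of "p * y + q * x"] by linarith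
    moreover have "0 \<le> c" using Yb by linarith
    ultimately show ?thesis by (rule power2_le_imp_le)
  qed
  have fY: "(f (Y t))\<^sup>2 + (Y t)\<^sup>2 = c\<^sup>2" if "t \<in> {a..b}" for t
    using abs_le_square_iff[of "Y t" c] Yc[OF that] by (simp add: f_def)
  have unit: "(Y' t)\<^sup>2 + (X' t)\<^sup>2 = 1" for t by (simp add: X'_def Y'_def)
  have "integral {Y s\<^sub>0..Y b} f + i2 \<le> (b - s\<^sub>0) * c"
  proof (rule has_integral_le[OF has_integral_add[OF I1 I4(2)]])
    show "((\<lambda>_. c) has_integral (b - s\<^sub>0) * c) {s\<^sub>0..b}"
      using has_integral_const_real[of c s\<^sub>0 b] s0 by simp
    fix t assume "t \<in> {s\<^sub>0..b}"
    then show "Y' t *\<^sub>R f (Y t) + - Y t * X' t \<le> c"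
      using cs[OF fY unit, of t t] s0 by simp
  qed
  moreover have "integral {- Y a..- Y s\<^sub>0} f + i1 \<le> (s\<^sub>0 - a) * c"
  proof (rule has_integral_le[OF has_integral_add[OF I2 I4(1)]])
    show "((\<lambda>_. c) has_integral (s\<^sub>0 - a) * c) {a..s\<^sub>0}"
      using has_integral_const_real[of c a s\<^sub>0] s0 by simp
    fix t assume "t \<in> {a..s\<^sub>0}"
    moreover have "(- Y' t)\<^sup>2 + (X' t)\<^sup>2 = 1" "f (- Y t) = f (Y t)" using unit by (simp_all add: f_def)
    ultimately show "- Y' t *\<^sub>R f (- Y t) + - Y t * X' t \<le> c"
      using cs[OF fY, of t "- Y' t" "X' t"] s0 by simp
  qed
  ultimately show "area + pi * (h s\<^sub>0)\<^sup>2 / 2 \<le> (b - a) * h s\<^sub>0"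
    using I12 i12 by (simp add: c_def algebra_simps)
qed

lemma \<kappa>_has_integral: "(\<kappa> has_integral pi) {a..b}"
  using primitive_on_has_integral[OF \<phi>, of a b] ab turn by simp

text \<open>Minkowski's formula: integrate by parts the real part of
  \<open>cnj (\<gamma> s - m) * cis (\<phi> s)\<close>. Both factors change sign between the ends,
  so the boundary terms cancel.\<close>

lemma \<kappa>_h_has_integral: "((\<lambda>s. \<kappa> s * h s) has_integral (b - a)) {a..b}"
proof -
  have G: "primitive_on (\<lambda>s. cnj (\<gamma> s - m)) (\<lambda>s. cnj (T s)) a b"
    by (rule primitive_on_linear[OF _ bounded_linear_cnj], rule primitive_on_C1[OF _ continuous_T])
      (use deriv in \<open>auto intro!: derivative_eq_intros\<close>)
  have "primitive_on (\<lambda>s. Re (cnj (\<gamma> s - m) * cis (\<phi> s)))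
     (\<lambda>s. Re (cnj (T s) * cis (\<phi> s) + cnj (\<gamma> s - m) * (\<i> * \<kappa> s * cis (\<phi> s)))) a b"
    by (intro primitive_on_linear[OF _ bounded_linear_Re] primitive_on_mult G primitive_on_cis \<phi>)
  from primitive_on_has_integral[OF this order_refl less_imp_le[OF ab] order_refl]
  have "((\<lambda>s. Re (cnj (T s) * cis (\<phi> s) + cnj (\<gamma> s - m) * (\<i> * \<kappa> s * cis (\<phi> s)))) has_integral 0) {a..b}"
    by (simp only: ends complex_cnj_minus minus_mult_minus diff_self)
  moreover have "Re (cnj (T s) * cis (\<phi> s) + cnj (\<gamma> s - m) * (\<i> * \<kappa> s * cis (\<phi> s))) = 1 - \<kappa> s * h s"
    if "s \<in> {a..b}" for s
  proof -
    have "cnj (T s) * cis (\<phi> s) = 1" using that by (simp add: T cis_cnj cis_mult)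
    moreover have "Re (cnj (\<gamma> s - m) * (\<i> * \<kappa> s * cis (\<phi> s))) = - (\<kappa> s * h s)"
      using that by (simp add: h_def T algebra_simps)
    ultimately show ?thesis by simp
  qed
  ultimately have "((\<lambda>s. 1 - \<kappa> s * h s) has_integral 0) {a..b}" by (rule has_integral_eq[rotated])
  from has_integral_diff[OF has_integral_const_real[of 1 a b] this] show ?thesis using ab by simp
qed

text \<open>With zero area the continuous nonnegative \<open>h\<close> would vanish identically, and
  Minkowski's formula would give an arc of length zero.\<close>

lemma area_pos: "area > 0"
proof -
  have "area \<ge> 0"
    using has_integral_nonneg[OF h_has_integral] bonnesen(1) by force
  moreover have "area \<noteq> 0"
  proof
    assume "area = 0"
    then have "integral {a..b} h = 0" by (simp add: area_def)
    then have "h s = 0" if "s \<in> {a..b}" for s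
      using integral_eq_0_iff[OF continuous_h ab] bonnesen(1) that by blast
    then have "((\<lambda>s. \<kappa> s * h s) has_integral 0) {a..b}"
      by (intro has_integral_is_0) auto
    then show False using has_integral_unique[OF \<kappa>_h_has_integral] ab by force
  qed
  ultimately show ?thesis by simp
qed

text \<open>\<open>x\<close> and \<open>y\<close> are the roots of the quadratic
  \<open>pi * t^2 / 2 - (b - a) * t + area\<close> in Bonnesen's inequality, between which
  \<open>h\<close> takes its values. The last clause records that a double root fixes the length,
  which the equality case requires.\<close>

lemma energy_ge_aux:
  assumes p: "p > 1" and int: "(\<lambda>s. \<kappa> s powr p) integrable_on {a..b}"
  obtains x y where "x > 0" "y > 0" "x * y = 2 * area / pi"
    "pi / 2 * (x powr (1 - p) + y powr (1 - p)) \<le> integral {a..b} (\<lambda>s. \<kappa> s powr p)"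
    "x = y \<Longrightarrow> x = (b - a) / pi"
proof -
  define l where "l = (b - a) / pi"
  have l: "l > 0" using ab by (simp add: l_def)
  have sq: "(l - h s)\<^sup>2 \<le> l\<^sup>2 - 2 * area / pi" if "s \<in> {a..b}" for s
  proof -
    have "2 / pi * (area + pi * (h s)\<^sup>2 / 2) \<le> 2 / pi * (pi * l * h s)"
      using bonnesen(2)[OF that] by (intro mult_left_mono) (auto simp: l_def)
    then show ?thesis by (simp add: power2_eq_square algebra_simps)
  qed
  define \<delta> where "\<delta> = sqrt (l\<^sup>2 - 2 * area / pi)"
  have "0 \<le> l\<^sup>2 - 2 * area / pi"
    using sq[of a] ab order_trans[OF zero_le_power2] by fastforce
  then have \<delta>: "\<delta> \<ge> 0" "\<delta>\<^sup>2 = l\<^sup>2 - 2 * area / pi" by (simp_all add: \<delta>_def)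
  have abs: "\<bar>l - h s\<bar> \<le> \<delta>" if "s \<in> {a..b}" for s
    using abs_le_square_iff[of "l - h s" \<delta>] sq[OF that] \<delta> by simp
  \<comment> \<open>if \<open>\<delta> = 0\<close> then \<open>h\<close> is constantly \<open>l\<close>, and \<open>u = 0\<close> is what is needed\<close>
  define u where "u = (\<lambda>s. (l - h s) / \<delta>)"
  have u: "\<bar>u s\<bar> \<le> 1" if "s \<in> {a..b}" for s
    using abs[OF that] \<delta>(1) by (cases "\<delta> = 0") (auto simp: u_def)
  have "((\<lambda>s. l - h s) has_integral (b - a) * l - 2 * area) {a..b}"
    using has_integral_diff[OF has_integral_const_real[of l a b] h_has_integral] ab by simp
  then have "(u has_integral ((b - a) * l - 2 * area) / \<delta>) {a..b}"
    unfolding u_def by (rule has_integral_divide)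
  moreover have "(b - a) * l - 2 * area = pi * \<delta>\<^sup>2"
    unfolding \<delta>(2) by (simp add: l_def field_simps power2_eq_square)
  ultimately have Iu: "(u has_integral pi * \<delta>) {a..b}"
    by (cases "\<delta> = 0") (auto simp: power2_eq_square)
  have "((\<lambda>s. \<kappa> s * l - \<kappa> s * h s) has_integral pi * l - (b - a)) {a..b}"
    by (intro has_integral_diff has_integral_mult_left \<kappa>_has_integral \<kappa>_h_has_integral)
  then have "((\<lambda>s. (\<kappa> s * l - \<kappa> s * h s) / \<delta>) has_integral (pi * l - (b - a)) / \<delta>) {a..b}"
    by (rule has_integral_divide)
  moreover have "(\<lambda>s. (\<kappa> s * l - \<kappa> s * h s) / \<delta>) = (\<lambda>s. \<kappa> s * u s)"
    by (auto simp: u_def algebra_simps)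
  ultimately have I\<kappa>u: "((\<lambda>s. \<kappa> s * u s) has_integral 0) {a..b}" by (simp add: l_def)
  define x y where "x = l + \<delta>" and "y = l - \<delta>"
  have xy: "x * y = 2 * area / pi"
    using \<delta>(2) by (simp add: x_def y_def power2_eq_square algebra_simps)
  have x: "x > 0" using l \<delta> by (simp add: x_def)
  \<comment> \<open>Positivity of the smaller root comes from the product of the roots, so from
    positive area.\<close>
  then have y: "y > 0" using xy area_pos by (smt (verit) divide_pos_pos mult_nonneg_nonpos pi_gt_zero)
  \<comment> \<open>The weight \<open>(1 + \<sigma> * u s) / 2\<close> has integral
    \<open>pi * v / 2\<close>, and its integral against \<kappa> is \<open>pi / 2\<close>. Thus
    \<open>1 / v\<close> is the weighted mean of \<kappa>, and the tangent line there integrates to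
    its value at the mean; \<sigma> is 1 for \<open>x\<close> and - 1 for \<open>y\<close>.\<close>
  have weighted: "((\<lambda>s. (p * \<kappa> s * (1 / v) powr (p - 1) - (p - 1) * (1 / v) powr p) * ((1 + \<sigma> * u s) / 2))
       has_integral pi / 2 * v powr (1 - p)) {a..b}"
    if v: "v = l + \<sigma> * \<delta>" "v > 0" for v \<sigma> :: real
  proof -
    let ?A = "p * (1 / v) powr (p - 1) / 2" and ?B = "(p - 1) * (1 / v) powr p / 2"
    have "((\<lambda>s. ?A * (\<kappa> s + \<sigma> * (\<kappa> s * u s)) - ?B * (1 + \<sigma> * u s)) has_integral
       ?A * (pi + \<sigma> * 0) - ?B * ((b - a) + \<sigma> * (pi * \<delta>))) {a..b}"
      using has_integral_const_real[of "1::real" a b] ab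
      by (intro has_integral_diff has_integral_mult_right has_integral_add \<kappa>_has_integral I\<kappa>u Iu) simp
    moreover have "(\<lambda>s. ?A * (\<kappa> s + \<sigma> * (\<kappa> s * u s)) - ?B * (1 + \<sigma> * u s)) =
       (\<lambda>s. (p * \<kappa> s * (1 / v) powr (p - 1) - (p - 1) * (1 / v) powr p) * ((1 + \<sigma> * u s) / 2))"
      by (rule ext) (simp add: field_simps)
    moreover have "?A * (pi + \<sigma> * 0) - ?B * ((b - a) + \<sigma> * (pi * \<delta>)) = pi / 2 * v powr (1 - p)"
    proof -
      have "(b - a) + \<sigma> * (pi * \<delta>) = pi * v" by (simp add: v(1) l_def field_simps)
      moreover have "(1 / v) powr p * v = (1 / v) powr (p - 1)" using v(2) by (simp add: powr_diff)
      moreover have "?B * (pi * v) = (p - 1) / 2 * pi * ((1 / v) powr p * v)" by simp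
      moreover have "(1 / v) powr (p - 1) = v powr (1 - p)"
        using powr_minus[of v "p - 1"] v(2) by (simp add: powr_divide inverse_eq_divide)
      ultimately show ?thesis by (simp add: field_simps)
    qed
    ultimately show ?thesis by (simp only:)
  qed
  have lower: "((\<lambda>s. (p * \<kappa> s * (1 / x) powr (p - 1) - (p - 1) * (1 / x) powr p) * ((1 + u s) / 2)
      + (p * \<kappa> s * (1 / y) powr (p - 1) - (p - 1) * (1 / y) powr p) * ((1 - u s) / 2))
       has_integral pi / 2 * x powr (1 - p) + pi / 2 * y powr (1 - p)) {a..b}"
    using has_integral_add[OF weighted[of x 1] weighted[of y "- 1"]] x y by (simp add: x_def y_def)
  have "pi / 2 * x powr (1 - p) + pi / 2 * y powr (1 - p) \<le> integral {a..b} (\<lambda>s. \<kappa> s powr p)"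
  proof (rule has_integral_le[OF lower integrable_integral[OF int]])
    fix s assume s: "s \<in> {a..b}"
    have "(p * \<kappa> s * (1 / x) powr (p - 1) - (p - 1) * (1 / x) powr p) * ((1 + u s) / 2)
      \<le> \<kappa> s powr p * ((1 + u s) / 2)"
      using powr_ge_tangent(1)[OF p \<kappa>[OF s], of "1 / x"] x u[OF s] by (intro mult_right_mono) auto
    moreover have "(p * \<kappa> s * (1 / y) powr (p - 1) - (p - 1) * (1 / y) powr p) * ((1 - u s) / 2)
      \<le> \<kappa> s powr p * ((1 - u s) / 2)"
      using powr_ge_tangent(1)[OF p \<kappa>[OF s], of "1 / y"] y u[OF s] by (intro mult_right_mono) auto
    moreover have "\<kappa> s powr p * ((1 + u s) / 2) + \<kappa> s powr p * ((1 - u s) / 2) = \<kappa> s powr p"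
      by (simp add: field_simps)
    ultimately show "(p * \<kappa> s * (1 / x) powr (p - 1) - (p - 1) * (1 / x) powr p) * ((1 + u s) / 2)
      + (p * \<kappa> s * (1 / y) powr (p - 1) - (p - 1) * (1 / y) powr p) * ((1 - u s) / 2) \<le> \<kappa> s powr p"
      by linarith
  qed
  then have "pi / 2 * (x powr (1 - p) + y powr (1 - p)) \<le> integral {a..b} (\<lambda>s. \<kappa> s powr p)"
    by (simp add: algebra_simps)
  moreover have "x = (b - a) / pi" if "x = y" using that by (simp add: x_def y_def l_def)
  ultimately show ?thesis using that x y xy by blast
qed

lemma energy_ge:
  assumes p: "p > 1" and int: "(\<lambda>s. \<kappa> s powr p) integrable_on {a..b}"
  shows "pi * (2 * area / pi) powr ((1 - p) / 2) \<le> integral {a..b} (\<lambda>s. \<kappa> s powr p)"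
proof -
  obtain x y where xy: "x > 0" "y > 0" "x * y = 2 * area / pi"
    "pi / 2 * (x powr (1 - p) + y powr (1 - p)) \<le> integral {a..b} (\<lambda>s. \<kappa> s powr p)"
    using energy_ge_aux[OF assms] by metis
  have "pi / 2 * (2 * (x * y) powr ((1 - p) / 2)) \<le> pi / 2 * (x powr (1 - p) + y powr (1 - p))"
    using powr_add_ge_geometric_mean(1)[OF xy(1,2), of "1 - p"] p by (intro mult_left_mono) auto
  then show ?thesis using xy(4) unfolding xy(3) by linarith
qed

text \<open>Equality makes the two roots coincide, so the length is \<open>pi * x\<close> and the
  unweighted mean of \<kappa> is \<open>1 / x\<close>. The tangent line defect at
  \<open>1 / x\<close> is then nonnegative with integral zero, and strict convexity gives \<kappa> =
  \<open>1 / x\<close> almost everywhere.\<close>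

lemma energy_eq_imp:
  assumes p: "p > 1" and int: "(\<lambda>s. \<kappa> s powr p) integrable_on {a..b}"
    and eq: "integral {a..b} (\<lambda>s. \<kappa> s powr p) = pi * (2 * area / pi) powr ((1 - p) / 2)"
  shows "negligible {s\<in>{a..b}. \<kappa> s \<noteq> 1 / sqrt (2 * area / pi)}"
proof -
  obtain x y where xy: "x > 0" "y > 0" "x * y = 2 * area / pi"
    "pi / 2 * (x powr (1 - p) + y powr (1 - p)) \<le> integral {a..b} (\<lambda>s. \<kappa> s powr p)"
    and x: "x = y \<Longrightarrow> x = (b - a) / pi"
    using energy_ge_aux[OF p int] by metis
  have "pi / 2 * (x powr (1 - p) + y powr (1 - p)) \<le> pi / 2 * (2 * (x * y) powr ((1 - p) / 2))"
    using xy eq by simp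
  then have "x powr (1 - p) + y powr (1 - p) \<le> 2 * (x * y) powr ((1 - p) / 2)"
    by (simp only: mult_le_cancel_left_pos pi_half_gt_zero)
  then have "x powr (1 - p) + y powr (1 - p) = 2 * (x * y) powr ((1 - p) / 2)"
    using powr_add_ge_geometric_mean(1)[OF xy(1,2), of "1 - p"] p by (intro antisym) auto
  then have "x = y"
    using powr_add_ge_geometric_mean(2)[OF xy(1,2), of "1 - p"] p by simp
  then have len: "b - a = pi * x" using x by simp
  have sx: "sqrt (2 * area / pi) = x" using xy \<open>x = y\<close> by (simp flip: xy(3))
  let ?g = "\<lambda>s. p * \<kappa> s * (1 / x) powr (p - 1) - (p - 1) * (1 / x) powr p"
  have "?g = (\<lambda>s. p * (1 / x) powr (p - 1) * \<kappa> s - (p - 1) * (1 / x) powr p)" by (simp add: mult_ac)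
  then have g: "(?g has_integral p * (1 / x) powr (p - 1) * pi - (pi * x) * ((p - 1) * (1 / x) powr p)) {a..b}"
    using has_integral_diff[OF has_integral_mult_right[OF \<kappa>_has_integral] has_integral_const_real] ab len
    by simp
  have "(1 / x) powr p * x = (1 / x) powr (p - 1)" using xy(1) by (simp add: powr_diff)
  then have "p * (1 / x) powr (p - 1) * pi - (pi * x) * ((p - 1) * (1 / x) powr p) = pi * (1 / x) powr (p - 1)"
    by (simp add: algebra_simps)
  also have "\<dots> = pi * x powr (1 - p)"
    using xy(1) powr_minus[of x "p - 1"] by (simp add: powr_divide inverse_eq_divide)
  also have "x powr (1 - p) = (2 * area / pi) powr ((1 - p) / 2)"
    using xy(1) by (simp add: powr_mult \<open>x = y\<close>[symmetric] flip: xy(3) powr_add)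
  finally have "((\<lambda>s. \<kappa> s powr p - ?g s) has_integral 0) {a..b}"
    using has_integral_diff[OF integrable_integral[OF int] g] eq by simp
  moreover have ge: "\<kappa> s powr p - ?g s \<ge> 0" if "s \<in> {a..b}" for s
    using powr_ge_tangent(1)[OF p \<kappa>[OF that], of "1 / x"] xy(1) by simp
  ultimately have "negligible {s\<in>{a..b}. \<kappa> s powr p - ?g s \<noteq> 0}"
    by (rule negligible_of_has_integral_0)
  moreover have "{s\<in>{a..b}. \<kappa> s \<noteq> 1 / sqrt (2 * area / pi)} \<subseteq> {s\<in>{a..b}. \<kappa> s powr p - ?g s \<noteq> 0}"
    using powr_ge_tangent(2)[OF p \<kappa>, of _ "1 / x"] xy(1) sx by auto
  ultimately show ?thesis by (rule negligible_subset)
qed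

end

section \<open>The boundary curve of a convex set\<close>

locale convex_W2p_curve =
  fixes p :: real and \<Omega> :: "complex set" and \<gamma> T g :: "real \<Rightarrow> complex" and L :: real
  assumes p: "p > 1"
    and param: "convex_W2p_boundary_param p \<Omega> \<gamma> L T g"
    and int_ne: "interior \<Omega> \<noteq> {}"
begin

lemma arclength: "arclength_W2p_closed_curve p \<gamma> L T g"
  and convex: "convex \<Omega>" and bounded: "bounded \<Omega>"
  and simple: "simple_path (unit_path \<gamma> L)"
  using param by (simp_all add: convex_W2p_boundary_param_def)

lemma L_pos: "L > 0"
  and deriv: "s \<in> {0..L} \<Longrightarrow> (\<gamma> has_vector_derivative T s) (at s within {0..L})"
  and norm_T: "s \<in> {0..L} \<Longrightarrow> norm (T s) = 1"
  and closed_curve: "\<gamma> 0 = \<gamma> L" "T 0 = T L"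
  and g_absint: "g absolutely_integrable_on {0..L}"
  and g_powr: "(\<lambda>s. norm (g s) powr p) integrable_on {0..L}"
  and prim_T: "primitive_on T g 0 L"
  using arclength unfolding arclength_W2p_closed_curve_def primitive_on_def by blast+

lemma winding: "z \<in> interior \<Omega> \<Longrightarrow> winding_number (unit_path \<gamma> L) z = 1"
  and path_image_unit_path: "path_image (unit_path \<gamma> L) = frontier \<Omega>"
  using param by (simp_all add: convex_W2p_boundary_param_def)

lemma image_\<gamma>: "\<gamma> ` {0..L} = frontier \<Omega>"
proof -
  have "(\<lambda>t. L * t) ` {0..1} = {0..L}"
    using L_pos by (simp add: image_mult_atLeastAtMost)
  then show ?thesis
    by (simp add: path_image_unit_path[symmetric] path_image_def unit_path_def flip: image_image)
qed

lemma \<gamma>_frontier: "s \<in> {0..L} \<Longrightarrow> \<gamma> s \<in> frontier \<Omega>"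
  using image_\<gamma> by blast

lemma \<gamma>_closure: "s \<in> {0..L} \<Longrightarrow> \<gamma> s \<in> closure \<Omega>"
  using \<gamma>_frontier by (simp add: frontier_def)

lemma \<gamma>_ne_interior: "s \<in> {0..L} \<Longrightarrow> z \<in> interior \<Omega> \<Longrightarrow> \<gamma> s \<noteq> z"
  using \<gamma>_frontier by (auto simp: frontier_def)

lemma inj_\<gamma>: "inj_on \<gamma> {0<..<L}"
proof (rule inj_onI)
  fix s t assume st: "s \<in> {0<..<L}" "t \<in> {0<..<L}" "\<gamma> s = \<gamma> t"
  have "unit_path \<gamma> L (s / L) = unit_path \<gamma> L (t / L)"
    using st L_pos by (simp add: unit_path_def)
  moreover have inj: "\<And>x y. x \<in> {0..1} \<Longrightarrow> y \<in> {0..1} \<Longrightarrow> unit_path \<gamma> L x = unit_path \<gamma> L y \<Longrightarrow>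
      x = y \<or> x = 0 \<and> y = 1 \<or> x = 1 \<and> y = 0"
    using simple unfolding simple_path_def loop_free_def by blast
  ultimately have "s / L = t / L \<or> s / L = 0 \<and> t / L = 1 \<or> s / L = 1 \<and> t / L = 0"
    using st by (intro inj) auto
  then have "s / L = t / L" using st by auto
  then show "s = t" using L_pos by simp
qed

lemma continuous_T: "continuous_on {0..L} T"
  by (rule primitive_on_continuous[OF prim_T])

lemma continuous_\<gamma>: "continuous_on {0..L} \<gamma>"
  using deriv by (rule continuous_on_vector_derivative)

lemma prim_\<gamma>: "primitive_on \<gamma> T 0 L"
  by (rule primitive_on_C1[OF deriv continuous_T])

lemma deriv_at: "s \<in> {0<..<L} \<Longrightarrow> (\<gamma> has_vector_derivative T s) (at s)"
  using deriv[of s] at_within_interior[of s "{0..L}"] by (auto simp: interior_atLeastAtMost_real)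

text \<open>The winding number rewritten over arc length; it fixes the side of the supporting lines
  and, later, the total turning.\<close>

lemma winding_integral:
  assumes z: "z \<in> interior \<Omega>"
  shows "((\<lambda>s. T s / (\<gamma> s - z)) has_integral 2 * pi * \<i>) {0..L}"
proof -
  let ?q = "\<lambda>s. T s / (\<gamma> s - z)" and ?u = "unit_path \<gamma> L"
  have cq: "continuous_on {0..L} ?q"
    using \<gamma>_ne_interior[OF _ z] by (intro continuous_intros continuous_T continuous_\<gamma>) auto
  have Lt: "L * t \<in> {0<..<L}" if "t \<in> {0<..<1}" for t :: real
    using that L_pos by auto
  have du: "(?u has_vector_derivative L *\<^sub>R T (L * t)) (at t)" if "t \<in> {0<..<1}" for t
  proof -
    have "((\<lambda>t. L * t) has_vector_derivative L) (at t)"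
      by (auto intro!: derivative_eq_intros)
    from vector_diff_chain_at[OF this] deriv_at[OF Lt[OF that]]
    show ?thesis by (simp add: unit_path_def o_def)
  qed
  have cu: "continuous_on {0..1} ?u"
    unfolding unit_path_def using L_pos
    by (intro continuous_on_compose2[OF continuous_\<gamma>] continuous_intros) (auto simp: mult_left_le)
  have C1: "?u C1_differentiable_on ({0..1} - {0, 1})"
    unfolding C1_differentiable_on_def
  proof (intro exI conjI ballI)
    show "(?u has_vector_derivative L *\<^sub>R T (L * t)) (at t)" if "t \<in> {0..1} - {0, 1}" for t
      using du that by auto
    show "continuous_on ({0..1} - {0, 1}) (\<lambda>t. L *\<^sub>R T (L * t))"
      using L_pos by (intro continuous_intros continuous_on_compose2[OF continuous_T])
        (auto simp: mult_left_le)
  qed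
  \<comment> \<open>The ends of the parameter interval are exceptional because only one-sided
    derivatives are given there.\<close>
  have vp: "valid_path ?u"
    unfolding valid_path_def piecewise_C1_differentiable_on_def
    by (rule conjI[OF cu exI[of _ "{0, 1}"]]) (simp add: C1)
  have "z \<notin> path_image ?u" using z by (simp add: path_image_unit_path frontier_def)
  from has_contour_integral_winding_number[OF vp this]
  have "((\<lambda>t. 1 / (?u t - z) * vector_derivative ?u (at t within {0..1})) has_integral 2 * pi * \<i>) {0..1}"
    using winding[OF z] by (simp add: has_contour_integral_def)
  then have 1: "((\<lambda>t. L *\<^sub>R ?q (L * t)) has_integral 2 * pi * \<i>) {0..1}"
  proof (rule has_integral_spike_finite[rotated 2])
    fix t assume t: "t \<in> {0..1} - {0, 1::real}"
    have "vector_derivative ?u (at t within {0..1}) = L *\<^sub>R T (L * t)"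
      using t by (intro vector_derivative_within_cbox[of 0 1, simplified]
          has_vector_derivative_at_within[OF du]) auto
    then show "L *\<^sub>R ?q (L * t) = 1 / (?u t - z) * vector_derivative ?u (at t within {0..1})"
      by (simp add: unit_path_def scaleR_conv_of_real)
  qed auto
  have 2: "((\<lambda>t. L *\<^sub>R ?q (L * t)) has_integral integral {L * 0..L * 1} ?q) {0..1}"
    using L_pos cq by (intro has_integral_substitution[where c = 0 and d = L])
      (auto intro!: derivative_eq_intros simp: mult_left_le)
  have "integral {0..L} ?q = 2 * pi * \<i>"
    using has_integral_unique[OF 2 1] by simp
  then show ?thesis
    using integrable_integral[OF integrable_continuous_real[OF cq]] by simp
qed

text \<open>Moving \<open>z\<close> by a small \<open>e\<close> against the inner normal
  \<open>\<i> * w\<close> stays inside the set, so the supporting inequality holds at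
  \<open>z\<close> with slack \<open>e\<close>.\<close>

lemma Im_pos_of_interior:
  assumes "z \<in> interior \<Omega>" "norm w = 1" "\<And>y. y \<in> closure \<Omega> \<Longrightarrow> Im (cnj w * (y - x)) \<ge> 0"
  shows "Im (cnj w * (z - x)) > 0"
proof -
  obtain e where e: "e > 0" "cball z e \<subseteq> \<Omega>"
    using assms(1) by (auto simp: mem_interior_cball)
  have "z - e * \<i> * w \<in> cball z e" using e assms(2) by (simp add: dist_norm norm_mult)
  then have "Im (cnj w * (z - e * \<i> * w - x)) \<ge> 0"
    using e(2) closure_subset by (intro assms(3)) blast
  moreover have "cnj w * (z - e * \<i> * w - x) = cnj w * (z - x) - e * \<i> * (cnj w * w)"
    by (simp add: algebra_simps)
  moreover have "cnj w * w = 1" using assms(2) by (simp add: complex_norm_square[symmetric] mult.commute)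
  ultimately show ?thesis using e(1) by simp
qed

text \<open>A supporting line at an interior point of the parameter interval is tangent; the sign of its
  normal is constant along the curve, and is determined by the winding number.\<close>

lemma support:
  assumes s: "s \<in> {0..L}" and y: "y \<in> closure \<Omega>"
  shows "Im (cnj (T s) * (y - \<gamma> s)) \<ge> 0"
proof -
  obtain z where z: "z \<in> interior \<Omega>" using int_ne by blast
  have tangent: "\<exists>\<mu>. \<mu> \<noteq> 0 \<and> (\<forall>y\<in>closure \<Omega>. \<mu> * Im (cnj (T s) * (y - \<gamma> s)) \<ge> 0)"
    if s: "s \<in> {0<..<L}" for s
  proof -
    have "\<gamma> s \<in> closure \<Omega>" "\<gamma> s \<notin> rel_interior \<Omega>"
      using \<gamma>_frontier[of s] s int_ne by (auto simp: frontier_def rel_interior_nonempty_interior)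
    then obtain a where a: "a \<noteq> 0" "\<And>y. y \<in> closure \<Omega> \<Longrightarrow> a \<bullet> \<gamma> s \<le> a \<bullet> y"
      using supporting_hyperplane_relative_frontier[OF convex] by metis
    \<comment> \<open>Along the curve the supporting functional has a local minimum at
      \<open>s\<close>, an interior parameter; its derivative vanishes and \<open>a\<close> is a
      multiple \<mu> of the normal \<open>\<i> * T s\<close>.\<close>
    have "((\<lambda>t. a \<bullet> \<gamma> t) has_real_derivative a \<bullet> T s) (at s)"
      using bounded_linear.has_vector_derivative[OF bounded_linear_inner_right deriv_at[OF s]]
      by (simp add: has_real_derivative_iff_has_vector_derivative)
    moreover have "0 < min s (L - s)" using s by simp
    moreover have "a \<bullet> \<gamma> s \<le> a \<bullet> \<gamma> t" if "\<bar>s - t\<bar> < min s (L - s)" for t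
      using that by (intro a(2) \<gamma>_closure) auto
    ultimately have orth: "a \<bullet> T s = 0" using DERIV_local_min by blast
    define \<mu> where "\<mu> = a \<bullet> (\<i> * T s)"
    have nT: "(Re (T s))\<^sup>2 + (Im (T s))\<^sup>2 = 1"
      using norm_T[of s] s by (simp add: cmod_def)
    have a\<mu>: "a = \<mu> * \<i> * T s"
    proof -
      have "Re a = (Re a * ((Re (T s))\<^sup>2 + (Im (T s))\<^sup>2))" "Im a = (Im a * ((Re (T s))\<^sup>2 + (Im (T s))\<^sup>2))"
        by (simp_all add: nT)
      moreover have "Re a * Re (T s) = - (Im a * Im (T s))" using orth by (simp add: inner_complex_def)
      ultimately show ?thesis
        by (simp add: complex_eq_iff \<mu>_def inner_complex_def power2_eq_square) algebra
    qed
    have "\<mu> * Im (cnj (T s) * (y - \<gamma> s)) = a \<bullet> y - a \<bullet> \<gamma> s" for y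
      by (subst (1 2) a\<mu>) (simp add: inner_complex_def algebra_simps)
    then have "\<forall>y\<in>closure \<Omega>. \<mu> * Im (cnj (T s) * (y - \<gamma> s)) \<ge> 0" using a(2) by simp
    moreover have "\<mu> \<noteq> 0" using a(1) a\<mu> by auto
    ultimately show ?thesis by blast
  qed
  define k where "k = (\<lambda>s. Im (cnj (T s) * (z - \<gamma> s)))"
  have ck: "continuous_on {0..L} k"
    unfolding k_def by (intro continuous_intros continuous_T continuous_\<gamma>)
  have kne: "k s \<noteq> 0" if s: "s \<in> {0<..<L}" for s
  proof
    assume "k s = 0"
    obtain \<mu> where \<mu>: "\<mu> \<noteq> 0" "\<forall>y\<in>closure \<Omega>. \<mu> * Im (cnj (T s) * (y - \<gamma> s)) \<ge> 0"
      using tangent[OF s] by blast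
    have "Im (cnj (sgn \<mu> * T s) * (z - \<gamma> s)) > 0"
    proof (rule Im_pos_of_interior[OF z])
      show "norm (sgn \<mu> * T s) = 1" using \<mu>(1) norm_T[of s] s by (simp add: norm_mult sgn_real_def)
      show "Im (cnj (sgn \<mu> * T s) * (y - \<gamma> s)) \<ge> 0" if "y \<in> closure \<Omega>" for y
        using \<mu>(2) that \<mu>(1) by (cases "\<mu> > 0") (auto simp: sgn_real_def zero_le_mult_iff mult.assoc)
    qed
    moreover have "Im (cnj (sgn \<mu> * T s) * (z - \<gamma> s)) = sgn \<mu> * k s"
      by (simp add: k_def mult.assoc)
    ultimately have "0 < sgn \<mu> * k s" by (simp only:)
    then show False using \<open>k s = 0\<close> by simp
  qed
  \<comment> \<open>The sign of \<open>k\<close> is the sign of the imaginary part of the winding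
    integrand. Were \<open>k\<close> nowhere positive, the integral could not be
    \<open>2 * pi * \<i>\<close>.\<close>
  have Imq: "Im (T s / (\<gamma> s - z)) = k s / (norm (\<gamma> s - z))\<^sup>2" for s
    by (simp add: k_def Im_divide cmod_power2 algebra_simps)
  have "\<exists>s\<in>{0<..<L}. k s > 0"
  proof (rule ccontr)
    assume "\<not> ?thesis"
    then have neg: "k s \<le> 0" if "s \<in> {0<..<L}" for s using that by force
    have "((\<lambda>s. Im (T s / (\<gamma> s - z))) has_integral 2 * pi) {0<..<L}"
      using has_integral_Im[OF winding_integral[OF z]] by (simp add: has_integral_Icc_iff_Ioo)
    from has_integral_nonneg[OF has_integral_neg[OF this]] have "0 \<le> - (2 * pi)"
      using neg by (simp add: Imq divide_nonpos_nonneg)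
    then show False using pi_gt_zero by linarith
  qed
  then obtain s0 where s0: "s0 \<in> {0<..<L}" "k s0 > 0" by blast
  have kpos: "k s > 0" if s: "s \<in> {0<..<L}" for s
  proof (rule ccontr)
    assume "\<not> k s > 0"
    then have ks: "k s \<le> 0" by simp
    have "connected (k ` {0<..<L})"
      by (intro connected_continuous_image continuous_on_subset[OF ck]) auto
    moreover have "k s \<in> k ` {0<..<L}" "k s0 \<in> k ` {0<..<L}" using s s0(1) by blast+
    ultimately have "0 \<in> k ` {0<..<L}"
      by (rule connectedD_interval) (use ks s0(2) in simp_all)
    then show False using kne by auto
  qed
  have open_case: "Im (cnj (T s) * (y - \<gamma> s)) \<ge> 0" if s: "s \<in> {0<..<L}" for s
  proof -
    obtain \<mu> where \<mu>: "\<mu> \<noteq> 0" "\<forall>y\<in>closure \<Omega>. \<mu> * Im (cnj (T s) * (y - \<gamma> s)) \<ge> 0"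
      using tangent[OF s] by blast
    have "z \<in> closure \<Omega>" using z interior_subset closure_subset by blast
    then have "\<mu> * k s \<ge> 0" using \<mu>(2) by (simp add: k_def)
    then have "\<mu> > 0" using kpos[OF s] \<mu>(1) by (simp add: zero_le_mult_iff)
    then show ?thesis using \<mu>(2) y by (simp add: zero_le_mult_iff)
  qed
  have "closed ({0..L} \<inter> (\<lambda>s. Im (cnj (T s) * (y - \<gamma> s))) -` {0..})"
    by (intro continuous_closed_preimage continuous_intros continuous_T continuous_\<gamma>)
  moreover have "{0<..<L} \<subseteq> {0..L} \<inter> (\<lambda>s. Im (cnj (T s) * (y - \<gamma> s))) -` {0..}"
    using open_case by auto
  ultimately have "closure {0<..<L} \<subseteq> {0..L} \<inter> (\<lambda>s. Im (cnj (T s) * (y - \<gamma> s))) -` {0..}"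
    by (rule closure_minimal[rotated])
  then show ?thesis using s L_pos by auto
qed

section \<open>The tangent angle: lifting, monotonicity and total turning\<close>

definition \<phi> :: "real \<Rightarrow> real" where "\<phi> s = Arg (T 0) + integral {0..s} (curvature T g)"

text \<open>Convexity makes the curvature nonnegative only almost everywhere, whereas half turn arcs
  ask for it everywhere; the truncation changes it on a null set.\<close>

definition \<kappa> :: "real \<Rightarrow> real" where "\<kappa> s = max 0 (curvature T g s)"

lemma curvature_absint: "curvature T g absolutely_integrable_on {0..L}"
proof -
  have "continuous_on {0..L} (\<lambda>s. cnj (T s))" by (intro continuous_intros continuous_T)
  from absolutely_integrable_linear[OF absolutely_integrable_continuous_mult[OF g_absint this] bounded_linear_Im]
  show ?thesis by (simp add: o_def curvature_def[abs_def])
qed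

lemma prim_\<phi>_curvature: "primitive_on \<phi> (curvature T g) 0 L"
  using curvature_absint by (simp add: primitive_on_def \<phi>_def)

lemma T_unit: "s \<in> {0..L} \<Longrightarrow> cnj (T s) * T s = 1"
  using norm_T[of s] by (simp add: complex_norm_square[symmetric] mult.commute)

text \<open>The density of the constant function \<open>cnj (T s) * T s\<close> vanishes almost
  everywhere, so \<open>g\<close> is almost everywhere normal to the tangent.\<close>

lemma g_ae: "negligible {s\<in>{0..L}. g s \<noteq> \<i> * curvature T g s * T s}"
proof -
  have "primitive_on (\<lambda>s. cnj (T s) * T s) (\<lambda>s. cnj (g s) * T s + cnj (T s) * g s) 0 L"
    by (intro primitive_on_mult primitive_on_linear[OF prim_T bounded_linear_cnj] prim_T)
  then have "negligible {s\<in>{0..L}. cnj (g s) * T s + cnj (T s) * g s \<noteq> 0}"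
    by (rule negligible_nonzero_of_const) (use L_pos in \<open>simp add: T_unit\<close>)
  moreover have "g s = \<i> * curvature T g s * T s"
    if s: "s \<in> {0..L}" and "cnj (g s) * T s + cnj (T s) * g s = 0" for s
  proof -
    have "Re (cnj (T s) * g s) = 0" using that(2) by (simp add: complex_eq_iff algebra_simps)
    then have "cnj (T s) * g s = \<i> * curvature T g s" by (simp add: complex_eq_iff curvature_def)
    then have "(cnj (T s) * T s) * g s = \<i> * curvature T g s * T s" by (simp add: mult_ac)
    then show ?thesis by (simp only: T_unit[OF s] mult_1)
  qed
  ultimately show ?thesis by (elim negligible_subset) blast
qed

text \<open>By the previous lemma \<open>T s * cis (- \<phi> s)\<close> has density zero almost
  everywhere, and it equals 1 at the start.\<close>

lemma T_cis: assumes "s \<in> {0..L}" shows "T s = cis (\<phi> s)"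
proof -
  have "primitive_on (\<lambda>s. - \<phi> s) (\<lambda>s. - curvature T g s) 0 L"
    by (rule primitive_on_linear[OF prim_\<phi>_curvature bounded_linear_minus[OF bounded_linear_ident]])
  from primitive_on_mult[OF prim_T primitive_on_cis[OF this]]
  have "T s * cis (- \<phi> s) = T 0 * cis (- \<phi> 0)"
    by (rule primitive_on_zero_const[OF _ g_ae _ assms]) (auto simp: algebra_simps)
  also have "T 0 * cis (- \<phi> 0) = 1"
  proof -
    have "T 0 = cis (Arg (T 0))" using norm_T[of 0] L_pos
      by (subst cis_Arg) (auto simp: sgn_eq)
    then show ?thesis by (simp add: \<phi>_def) (metis cis_mult cis_zero add.right_inverse)
  qed
  finally have "T s * (cis (- \<phi> s) * cis (\<phi> s)) = cis (\<phi> s)" by (simp add: mult.assoc[symmetric] del: cis_mult)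
  then show ?thesis by (simp add: cis_mult)
qed

text \<open>If the angle dropped by a small \<psi> between \<open>x\<close> and \<open>y\<close>,
  then \<open>\<gamma> y\<close> would lie ahead of \<open>\<gamma> x\<close> and not to the right
  of the tangent at \<open>x\<close>. Turning that tangent clockwise by \<psi> puts
  \<open>\<gamma> x\<close> strictly to the right of the tangent at \<open>y\<close>, against the
  supporting inequality there.\<close>

lemma \<phi>_mono:
  assumes st: "0 \<le> s" "s \<le> t" "t \<le> L"
  shows "\<phi> s \<le> \<phi> t"
proof -
  have c\<phi>: "continuous_on {0..L} \<phi>" by (rule primitive_on_continuous[OF prim_\<phi>_curvature])
  then have "uniformly_continuous_on {0..L} \<phi>" by (auto intro: compact_uniformly_continuous)
  \<comment> \<open>Angles within \<open>pi / 3\<close> have cosine at least \<open>1 / 2\<close>,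
    so the curve advances at least at half speed along its initial direction; this is the term
    \<open>t / 2\<close> in \<open>F\<close> below.\<close>
  moreover have "pi / 3 > 0" by simp
  ultimately obtain d where d: "d > 0" "\<And>x y. x \<in> {0..L} \<Longrightarrow> y \<in> {0..L} \<Longrightarrow> dist x y < d \<Longrightarrow> dist (\<phi> x) (\<phi> y) < pi / 3"
    unfolding uniformly_continuous_on_def by metis
  have loc: "\<phi> x \<le> \<phi> y" if xy: "0 \<le> x" "x < y" "y \<le> L" "y - x < d" for x y
  proof (rule ccontr)
    assume "\<not> \<phi> x \<le> \<phi> y"
    define \<psi> where "\<psi> = \<phi> x - \<phi> y"
    define u v where "u = Re (cnj (T x) * (\<gamma> y - \<gamma> x))" and "v = Im (cnj (T x) * (\<gamma> y - \<gamma> x))"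
    have close: "\<bar>\<phi> t - \<phi> x\<bar> < pi / 3" if "t \<in> {x..y}" for t
      using d(2)[of t x] that xy by (auto simp: dist_real_def)
    have \<psi>: "0 < \<psi>" "\<psi> < pi / 3"
      using \<open>\<not> \<phi> x \<le> \<phi> y\<close> close[of y] xy by (auto simp: \<psi>_def)
    have v: "v \<ge> 0"
      unfolding v_def using xy by (intro support \<gamma>_closure) auto
    have u: "u > 0"
    proof -
      define F where "F = (\<lambda>t. Re (cnj (T x) * (\<gamma> t - \<gamma> x)) - t / 2)"
      have "F x \<le> F y"
      proof (rule le_of_deriv_nonneg[where F = F and S = "{0..L}" and F' = "\<lambda>t. Re (cnj (T x) * T t) - 1 / 2"])
        fix t assume t: "t \<in> {0..L}"
        have "((\<lambda>t. Re (cnj (T x) * (\<gamma> t - \<gamma> x))) has_vector_derivative Re (cnj (T x) * T t)) (at t within {0..L})"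
          using deriv[OF t] by (intro bounded_linear.has_vector_derivative[OF bounded_linear_Re])
            (auto intro!: derivative_eq_intros)
        then show "(F has_real_derivative Re (cnj (T x) * T t) - 1 / 2) (at t within {0..L})"
          unfolding F_def has_real_derivative_iff_has_vector_derivative
          by (intro has_vector_derivative_diff) (auto intro!: derivative_eq_intros)
      next
        fix t assume t: "t \<in> {x..y}"
        have "cos (pi / 3) \<le> cos \<bar>\<phi> t - \<phi> x\<bar>"
          using close[OF t] by (intro cos_monotone_0_pi_le) auto
        moreover have "Re (cnj (T x) * T t) = cos (\<phi> t - \<phi> x)"
          using t xy by (simp add: T_cis cos_diff mult.commute)
        ultimately show "0 \<le> Re (cnj (T x) * T t) - 1 / 2" by (simp add: cos_60)
      qed (use xy in auto)
      then show ?thesis using xy by (simp add: F_def u_def)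
    qed
    have "cnj (T y) * (\<gamma> y - \<gamma> x) = cis \<psi> * (cnj (T x) * (\<gamma> y - \<gamma> x))"
      using xy by (simp add: T_cis cis_cnj mult.assoc[symmetric] cis_mult \<psi>_def)
    moreover have "Im (cnj (T y) * (\<gamma> x - \<gamma> y)) \<ge> 0"
      using xy by (intro support \<gamma>_closure) auto
    then have "Im (cnj (T y) * (\<gamma> y - \<gamma> x)) \<le> 0" by (simp add: algebra_simps)
    ultimately have "Im (cis \<psi> * (cnj (T x) * (\<gamma> y - \<gamma> x))) \<le> 0" by (simp only:)
    then have "cos \<psi> * v + sin \<psi> * u \<le> 0" by (simp add: u_def v_def)
    moreover have "cos \<psi> > 0" using \<psi> by (intro cos_gt_zero_pi) auto
    moreover have "sin \<psi> > 0" using \<psi> by (intro sin_gt_zero) auto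
    ultimately show False using u v by (smt (verit) mult_nonneg_nonneg mult_pos_pos)
  qed
  \<comment> \<open>Local monotonicity is globalized by the local-to-global bound, with
    \<open>H\<close> zero and \<phi> as the majorant.\<close>
  have "norm ((0::real) - 0) \<le> \<phi> t - \<phi> s"
  proof (rule norm_diff_le_of_local[OF st(2) d(1)])
    fix x y assume "s \<le> x" "x \<le> y" "y \<le> t" "y - x < d"
    then show "norm ((0::real) - 0) \<le> \<phi> y - \<phi> x"
      using loc[of x y] st by (cases "x = y") auto
  qed
  then show ?thesis by simp
qed

lemma \<kappa>_ae: "negligible {s\<in>{0..L}. \<kappa> s \<noteq> curvature T g s}"
  using negligible_neg_of_mono[OF prim_\<phi>_curvature \<phi>_mono]
  by (rule negligible_subset) (auto simp: \<kappa>_def)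

lemma prim_\<phi>: "primitive_on \<phi> \<kappa> 0 L"
  by (rule primitive_on_spike[OF prim_\<phi>_curvature \<kappa>_ae]) auto

lemma \<kappa>_nonneg: "\<kappa> s \<ge> 0"
  by (simp add: \<kappa>_def)

lemma energy_\<kappa>: "energy_p p L T g = integral {0..L} (\<lambda>s. \<kappa> s powr p)"
  unfolding energy_p_def by (rule integral_spike[OF \<kappa>_ae]) auto

lemma \<kappa>_powr_integrable: "(\<lambda>s. \<kappa> s powr p) integrable_on {0..L}"
proof (rule measurable_bounded_by_integrable_imp_integrable[OF _ g_powr])
  have "\<kappa> \<in> borel_measurable (lebesgue_on {0..L})"
    by (rule integrable_imp_measurable[OF primitive_on_integrable[OF prim_\<phi>]])
  then show "(\<lambda>s. \<kappa> s powr p) \<in> borel_measurable (lebesgue_on {0..L})"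
    by measurable
  fix s assume s: "s \<in> {0..L}"
  have "\<kappa> s \<le> norm (g s)"
    using abs_Im_le_cmod[of "cnj (T s) * g s"] norm_T[OF s]
    by (auto simp: \<kappa>_def curvature_def norm_mult)
  then show "norm (\<kappa> s powr p) \<le> norm (g s) powr p"
    using p by (simp add: powr_mono2 \<kappa>_nonneg)
qed auto

text \<open>Since \<open>T / (\<gamma> - z)\<close> takes values in the upper half plane, its logarithm returns to its initial
  value, so that the tangent turns as often as the curve winds around \<open>z\<close>.\<close>

lemma total_turn: "\<phi> L = \<phi> 0 + 2 * pi"
proof -
  obtain z where z: "z \<in> interior \<Omega>" using int_ne by blast
  define q where "q = (\<lambda>s. T s / (\<gamma> s - z))"
  define I where "I = (\<lambda>s. integral {0..s} q)"
  have ne: "\<gamma> s - z \<noteq> 0" if "s \<in> {0..L}" for s using \<gamma>_ne_interior[OF that z] by simp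
  have cq: "continuous_on {0..L} q"
    unfolding q_def using ne by (intro continuous_intros continuous_T continuous_\<gamma>) auto
  have qne: "q s \<noteq> 0" if "s \<in> {0..L}" for s
    using ne[OF that] norm_T[OF that] by (auto simp: q_def)
  have Imq: "Im (q s) > 0" if "s \<in> {0..L}" for s
  proof -
    have "Im (cnj (T s) * (z - \<gamma> s)) > 0"
      using that norm_T support by (intro Im_pos_of_interior[OF z]) auto
    moreover have "Im (q s) = Im (cnj (T s) * (z - \<gamma> s)) / (norm (\<gamma> s - z))\<^sup>2"
      by (simp add: q_def Im_divide cmod_power2 algebra_simps)
    ultimately show ?thesis using ne[OF that] by simp
  qed
  have dI: "(I has_vector_derivative q s) (at s within {0..L})" if "s \<in> {0..L}" for s
    unfolding I_def using that by (intro integral_has_vector_derivative[OF cq])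
  have d0: "((\<lambda>s. (\<gamma> s - z) * exp (- I s)) has_vector_derivative 0) (at s within {0..L})" if s: "s \<in> {0..L}" for s
  proof -
    have "((\<lambda>s. exp (- I s)) has_vector_derivative - q s * exp (- I s)) (at s within {0..L})"
      using field_vector_diff_chain_within[OF has_vector_derivative_minus[OF dI[OF s]]
          has_field_derivative_at_within[OF DERIV_exp]]
      by (simp add: o_def)
    from has_vector_derivative_mult[OF has_vector_derivative_diff[OF deriv[OF s] has_vector_derivative_const[of z]] this]
    have "((\<lambda>s. (\<gamma> s - z) * exp (- I s)) has_vector_derivative
        (\<gamma> s - z) * (- q s * exp (- I s)) + (T s - 0) * exp (- I s)) (at s within {0..L})" .
    moreover have "(\<gamma> s - z) * (- q s * exp (- I s)) + (T s - 0) * exp (- I s) = 0"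
      using ne[OF s] by (simp add: q_def)
    ultimately show ?thesis by (simp only:)
  qed
  \<comment> \<open>So \<open>\<gamma> s - z\<close> is \<open>c * exp (I s)\<close>: the integral
    \<open>I\<close> is a continuous logarithm of it up to a constant.\<close>
  obtain c where c: "\<And>s. s \<in> {0..L} \<Longrightarrow> (\<gamma> s - z) * exp (- I s) = c"
    by (rule has_vector_derivative_zero_constant[OF convex_real_interval(5) d0]) (assumption, rule that)
  have I0: "I 0 = 0" by (simp add: I_def)
  \<comment> \<open>Its exponential is constantly \<open>1 / c\<close>, so its values differ by
    multiples of \<open>2 * pi * \<i>\<close>. As \<open>q\<close> avoids the branch cut of
    \<open>Ln\<close>, \<open>W\<close> is continuous and therefore constant; comparing both ends
    gives the turning.\<close>
  define W where "W = (\<lambda>s. Ln (q s) - \<i> * \<phi> s + I s)"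
  have cW: "continuous_on {0..L} W"
    unfolding W_def using Imq
    by (intro continuous_intros cq primitive_on_continuous[OF prim_\<phi>] continuous_on_vector_derivative[OF dI])
      (auto simp: complex_nonpos_Reals_iff, force)
  have eW: "exp (W s) = exp (W 0)" if s: "s \<in> {0..L}" for s
  proof -
    have "exp (W s) = 1 / c" if s: "s \<in> {0..L}" for s
    proof -
      have "exp (W s) = q s * exp (- (\<i> * \<phi> s)) * exp (I s)"
        using qne[OF s] by (simp add: W_def exp_add exp_diff exp_minus field_simps)
      also have "q s * exp (- (\<i> * \<phi> s)) = 1 / (\<gamma> s - z)"
        using T_cis[OF s] ne[OF s] by (simp add: q_def cis_conv_exp field_simps flip: exp_add)
      also have "\<dots> * exp (I s) = 1 / c"
        using c[OF s] ne[OF s] by (simp add: exp_minus field_simps)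
      finally show ?thesis .
    qed
    then show ?thesis using s L_pos by simp
  qed
  have "W constant_on {0..L}"
  proof (rule continuous_discrete_range_constant[OF _ cW])
    show "connected {0..L}" by simp
    fix x assume x: "x \<in> {0..L}"
    show "\<exists>e>0. \<forall>y. y \<in> {0..L} \<and> W y \<noteq> W x \<longrightarrow> e \<le> norm (W y - W x)"
    proof (intro exI[of _ "2 * pi"] conjI allI impI)
      fix y assume y: "y \<in> {0..L} \<and> W y \<noteq> W x"
      then have "exp (W y) = exp (W x)" using eW x by metis
      then obtain n :: int where n: "W y = W x + of_int (2 * n) * pi * \<i>"
        by (auto simp: exp_eq)
      then have "n \<noteq> 0" using y by auto
      then have "\<bar>real_of_int n\<bar> \<ge> 1" by linarith
      then show "2 * pi \<le> norm (W y - W x)" by (simp add: n norm_mult)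
    qed simp
  qed
  then have "W L = W 0" using L_pos unfolding constant_on_def by force
  moreover have "q L = q 0" by (simp add: q_def closed_curve)
  moreover have "I L = 2 * pi * \<i>"
    using winding_integral[OF z] by (simp add: I_def q_def has_integral_iff)
  ultimately have "\<i> * complex_of_real (\<phi> L) = \<i> * complex_of_real (\<phi> 0 + 2 * pi)"
    by (simp add: W_def I0 algebra_simps)
  then show ?thesis by (simp only: mult_cancel_left complex_i_not_zero of_real_eq_iff) simp
qed

end

section \<open>Green's theorem\<close>

lemma measurable_Complex_pair:
  "(\<lambda>(x, y). Complex x y) \<in> borel_measurable (lborel \<Otimes>\<^sub>M lborel)"
proof -
  have "continuous_on UNIV (\<lambda>z::real \<times> real. Complex (fst z) (snd z))"
    unfolding Complex_eq by (intro continuous_intros)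
  then have "(\<lambda>z::real \<times> real. Complex (fst z) (snd z)) \<in> borel_measurable borel"
    by (rule borel_measurable_continuous_onI)
  then show ?thesis by (simp add: case_prod_unfold lborel_prod)
qed

text \<open>It suffices to compare the measures of boxes. The identification with a product measure
  makes Cavalieri's principle available for horizontal sections.\<close>

lemma lborel_complex: "distr (lborel \<Otimes>\<^sub>M lborel) borel (\<lambda>(x, y). Complex x y) = lborel"
proof (rule lborel_eqI[symmetric])
  fix l u :: complex assume lu: "\<And>b. b \<in> Basis \<Longrightarrow> l \<bullet> b \<le> u \<bullet> b"
  have "Re l \<le> Re u" "Im l \<le> Im u" using lu[of 1] lu[of \<i>] by (simp_all add: Basis_complex_def)
  have "(\<lambda>(x, y). Complex x y) -` box l u \<inter> space (lborel \<Otimes>\<^sub>M lborel) = {Re l<..<Re u} \<times> {Im l<..<Im u}"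
    by (auto simp: box_def Basis_complex_def space_pair_measure)
  then have "emeasure (distr (lborel \<Otimes>\<^sub>M lborel) borel (\<lambda>(x, y). Complex x y)) (box l u)
     = emeasure (lborel \<Otimes>\<^sub>M lborel) ({Re l<..<Re u} \<times> {Im l<..<Im u})"
    using measurable_Complex_pair by (subst emeasure_distr) auto
  also have "\<dots> = ennreal (Re u - Re l) * ennreal (Im u - Im l)"
    using \<open>Re l \<le> Re u\<close> \<open>Im l \<le> Im u\<close> by (simp add: lborel.emeasure_pair_measure_Times)
  finally show "emeasure (distr (lborel \<Otimes>\<^sub>M lborel) borel (\<lambda>(x, y). Complex x y)) (box l u)
     = ennreal (\<Prod>b\<in>Basis. (u - l) \<bullet> b)"
    using \<open>Re l \<le> Re u\<close> \<open>Im l \<le> Im u\<close> by (simp add: Basis_complex_def ennreal_mult)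
qed simp

lemma emeasure_lborel_complex:
  assumes "S \<in> sets (borel :: complex measure)"
  shows "emeasure lborel S = (\<integral>\<^sup>+y. emeasure lborel {x. Complex x y \<in> S} \<partial>lborel)"
proof -
  let ?C = "\<lambda>(x, y). Complex x y"
  have "emeasure lborel S = emeasure (lborel \<Otimes>\<^sub>M lborel) (?C -` S \<inter> space (lborel \<Otimes>\<^sub>M lborel))"
    using assms by (subst lborel_complex[symmetric], subst emeasure_distr[OF measurable_Complex_pair]) auto
  also have "\<dots> = (\<integral>\<^sup>+y. emeasure lborel ((\<lambda>x. (x, y)) -` (?C -` S \<inter> space (lborel \<Otimes>\<^sub>M lborel))) \<partial>lborel)"
    by (rule lborel_pair.emeasure_pair_measure_alt2[OF measurable_sets[OF measurable_Complex_pair assms]])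
  also have "\<dots> = (\<integral>\<^sup>+y. emeasure lborel {x. Complex x y \<in> S} \<partial>lborel)"
    by (intro nn_integral_cong arg_cong[where f = "emeasure lborel"]) (auto simp: space_pair_measure)
  finally show ?thesis .
qed

definition hsection :: "complex set \<Rightarrow> real \<Rightarrow> real set" where
  "hsection K y = {x. Complex x y \<in> K}"

lemma compact_section: "compact K \<Longrightarrow> compact (hsection K y)"
proof -
  assume K: "compact K"
  have "hsection K y = Re ` (K \<inter> {z. Im z = y})"
    by (force simp: hsection_def image_iff intro: exI[of _ "Complex _ y"])
  moreover have "compact (K \<inter> {z. Im z = y})"
    by (intro compact_Int_closed[OF K] closed_Collect_eq continuous_intros)
  ultimately show ?thesis
    by (auto intro!: compact_continuous_image continuous_intros)
qed

lemma convex_section: "convex K \<Longrightarrow> convex (hsection K y)"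
proof -
  assume K: "convex K"
  have "Complex (u * a + v * b) y \<in> K"
    if "Complex a y \<in> K" "Complex b y \<in> K" "0 \<le> u" "0 \<le> v" "u + v = 1" for a b u v
  proof -
    have "u *\<^sub>R Complex a y + v *\<^sub>R Complex b y \<in> K" using K that by (simp add: convexD)
    moreover have "u *\<^sub>R Complex a y + v *\<^sub>R Complex b y = Complex (u * a + v * b) y"
      using that(5) by (simp add: complex_eq_iff flip: distrib_right)
    ultimately show ?thesis by simp
  qed
  then show ?thesis by (auto simp: hsection_def convex_def)
qed

lemma hsection_interval:
  assumes "compact K" "convex K" "hsection K y \<noteq> {}"
  shows "x \<in> hsection K y \<longleftrightarrow> Inf (hsection K y) \<le> x \<and> x \<le> Sup (hsection K y)"
    and "Inf (hsection K y) \<le> Sup (hsection K y)"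
proof -
  have "connected (hsection K y)" "compact (hsection K y)"
    using assms by (simp_all add: compact_section convex_section convex_connected)
  then obtain a b where "hsection K y = {a..b}" using connected_compact_interval_1 by blast
  with assms(3) show "x \<in> hsection K y \<longleftrightarrow> Inf (hsection K y) \<le> x \<and> x \<le> Sup (hsection K y)"
    "Inf (hsection K y) \<le> Sup (hsection K y)" by auto
qed

lemma measure_eq_integral_sections:
  assumes K: "compact K" "convex K"
    and I: "((\<lambda>y. Sup (hsection K y) - Inf (hsection K y)) has_integral I) (Im ` K)"
  shows "measure lebesgue K = I"
proof -
  have ne: "hsection K y \<noteq> {} \<longleftrightarrow> y \<in> Im ` K" for y
  proof
    assume "hsection K y \<noteq> {}"
    then obtain x where "Complex x y \<in> K" by (auto simp: hsection_def)
    then show "y \<in> Im ` K" by (rule rev_image_eqI) simp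
  next
    assume "y \<in> Im ` K"
    then obtain z where "z \<in> K" "y = Im z" by blast
    then have "Re z \<in> hsection K y" by (simp add: hsection_def)
    then show "hsection K y \<noteq> {}" by blast
  qed
  have nonneg: "0 \<le> Sup (hsection K y) - Inf (hsection K y)" if "y \<in> Im ` K" for y
    using hsection_interval(2)[OF K, of y] that ne by simp
  \<comment> \<open>The indicator discards the heights with empty section, where \<open>Sup\<close>
    and \<open>Inf\<close> have no meaningful value.\<close>
  have "emeasure lborel (hsection K y) = ennreal (Sup (hsection K y) - Inf (hsection K y)) * indicator (Im ` K) y" for y
  proof (cases "y \<in> Im ` K")
    case True
    then have "hsection K y \<noteq> {}" using ne by simp
    note S = hsection_interval[OF K this]
    have "hsection K y = {Inf (hsection K y)..Sup (hsection K y)}"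
      by (rule set_eqI) (simp add: S(1))
    then have "emeasure lborel (hsection K y) = emeasure lborel {Inf (hsection K y)..Sup (hsection K y)}"
      by (rule arg_cong)
    then show ?thesis using True S(2) by simp
  next
    case False
    then have "hsection K y = {}" using ne by blast
    then show ?thesis using False by simp
  qed
  then have "emeasure lborel K = ennreal I"
    using nn_integral_has_integral_lebesgue'[OF nonneg I] K(1)
    by (subst emeasure_lborel_complex) (auto simp: hsection_def[symmetric] borel_compact)
  moreover have "0 \<le> I" using has_integral_nonneg[OF I nonneg] .
  ultimately have "measure lborel K = I" by (simp add: measure_def)
  then show ?thesis using K(1) by (simp add: borel_compact)
qed

context convex_W2p_curve
begin

abbreviation "K \<equiv> closure \<Omega>"

lemma compact_K: "compact K" and convex_K: "convex K"
  using bounded convex by (auto simp: compact_closure convex_closure)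

text \<open>Substitution yields integrals over the heights reached by a part of the curve. These can
  miss only the ends of the interval of interior heights and the height of the starting point, whose
  parameters are left out.\<close>

lemma has_integral_image_Im_iff:
  fixes I :: "real set" and f :: "real \<Rightarrow> real"
  assumes ex: "\<And>z. z \<in> interior \<Omega> \<Longrightarrow> Im z = Im (\<gamma> 0) \<or> (\<exists>s\<in>I. Im (\<gamma> s) = Im z)" and I: "I \<subseteq> {0..L}"
  shows "(f has_integral i) ((\<lambda>s. Im (\<gamma> s)) ` I) \<longleftrightarrow> (f has_integral i) (Im ` K)"
proof (rule has_integral_spike_set_eq)
  have "(\<lambda>s. Im (\<gamma> s)) ` I \<subseteq> Im ` K" using I \<gamma>_closure by auto
  then have empty: "{y \<in> (\<lambda>s. Im (\<gamma> s)) ` I - Im ` K. f y \<noteq> 0} = {}" by blast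
  show "negligible {y \<in> (\<lambda>s. Im (\<gamma> s)) ` I - Im ` K. f y \<noteq> 0}" unfolding empty by simp
  have cJ: "convex (Im ` interior \<Omega>)"
    by (intro convex_linear_image convex_interior convex bounded_linear.linear bounded_linear_Im)
  have "Im ` K = Im ` closure (interior \<Omega>)"
    using convex_closure_interior[OF convex int_ne] by simp
  also have "\<dots> \<subseteq> closure (Im ` interior \<Omega>)"
    by (intro image_closure_subset closed_closure closure_subset continuous_intros)
  finally have "Im ` K - (\<lambda>s. Im (\<gamma> s)) ` I \<subseteq> frontier (Im ` interior \<Omega>) \<union> {Im (\<gamma> 0)}"
  proof -
    assume sub: "Im ` K \<subseteq> closure (Im ` interior \<Omega>)"
    have "y \<in> frontier (Im ` interior \<Omega>)" 
      if "y \<in> Im ` K" "y \<notin> (\<lambda>s. Im (\<gamma> s)) ` I" "y \<noteq> Im (\<gamma> 0)" for y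
    proof -
      have "y \<notin> Im ` interior \<Omega>" using ex that by force
      then show ?thesis using that(1) sub interior_subset unfolding frontier_def by blast
    qed
    then show ?thesis by blast
  qed
  moreover have "negligible (frontier (Im ` interior \<Omega>) \<union> {Im (\<gamma> 0)})"
    by (intro negligible_Un negligible_convex_frontier cJ) simp
  ultimately show "negligible {y \<in> Im ` K - (\<lambda>s. Im (\<gamma> s)) ` I. f y \<noteq> 0}"
    by (elim negligible_subset) blast
qed

text \<open>At equal heights the supporting inequality reads as a sign condition on the horizontal
  displacement: an upward tangent has the set on its left, a downward one on its right.\<close>

lemma real_offset:
  assumes s: "s \<in> {0..L}" and z: "z \<in> K" "Im z = Im (\<gamma> s)"
  shows "Im (T s) * (Re z - Re (\<gamma> s)) \<le> 0"
    and "z \<in> interior \<Omega> \<Longrightarrow> Im (T s) * (Re z - Re (\<gamma> s)) < 0"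
proof -
  have eq: "Im (cnj (T s) * (z - \<gamma> s)) = - (Im (T s) * (Re z - Re (\<gamma> s)))" using z(2) by simp
  show "Im (T s) * (Re z - Re (\<gamma> s)) \<le> 0"
    using support[OF s z(1)] unfolding eq by simp
  show "Im (T s) * (Re z - Re (\<gamma> s)) < 0" if "z \<in> interior \<Omega>"
    using Im_pos_of_interior[OF that norm_T[OF s] support[OF s]] unfolding eq by simp
qed

text \<open>An end of the section that was interior to \<Omega> could be moved horizontally both
  ways, so it lies on the frontier, which the curve covers.\<close>

lemma section_at_interior:
  assumes z: "z \<in> interior \<Omega>" and x: "x \<in> {Inf (hsection K (Im z)), Sup (hsection K (Im z))}"
  shows "\<exists>s\<in>{0..L}. \<gamma> s = Complex x (Im z)"
proof -
  let ?S = "hsection K (Im z)"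
  have "Re z \<in> ?S" using z interior_subset closure_subset by (force simp: hsection_def)
  then have ne: "?S \<noteq> {}" by auto
  note S = hsection_interval[OF compact_K convex_K ne]
  have xS: "x \<in> ?S" using x S by auto
  have "Complex x (Im z) \<notin> interior \<Omega>"
  proof
    assume "Complex x (Im z) \<in> interior \<Omega>"
    then obtain e where e: "e > 0" "cball (Complex x (Im z)) e \<subseteq> \<Omega>"
      by (auto simp: mem_interior_cball)
    have "Complex (x + d) (Im z) \<in> K" if "\<bar>d\<bar> \<le> e" for d
    proof -
      have "Complex x (Im z) - Complex (x + d) (Im z) = of_real (- d)" by (simp add: complex_eq_iff)
      then have "Complex (x + d) (Im z) \<in> cball (Complex x (Im z)) e"
        using that by (simp add: dist_norm)
      then show ?thesis using e(2) closure_subset by blast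
    qed
    from this[of e] this[of "- e"] have "x + e \<in> ?S" "x - e \<in> ?S" using e(1) by (auto simp: hsection_def)
    then have "x + e \<le> Sup ?S" "Inf ?S \<le> x - e" using S(1) by blast+
    then show False using x e(1) by auto
  qed
  then have "Complex x (Im z) \<in> frontier \<Omega>" using xS by (simp add: hsection_def frontier_def)
  then show ?thesis using image_\<gamma> by (metis imageE)
qed

text \<open>On \<open>{Im T > 0}\<close> the curve parametrizes the right ends, on
  \<open>{Im T < 0}\<close> the left ends of the horizontal sections of \<open>\<Omega>\<close>.\<close>

lemma green_area: "((\<lambda>s. Re (\<gamma> s) * Im (T s)) has_integral measure lebesgue \<Omega>) {0..L}"
proof -
  let ?R = "\<lambda>y. Sup (hsection K y)" and ?Q = "\<lambda>y. Inf (hsection K y)" and ?y = "\<lambda>s. Im (\<gamma> s)"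
  let ?f = "\<lambda>s. Re (\<gamma> s) * Im (T s)"
  have ai: "?f absolutely_integrable_on {0..L}"
    by (intro absolutely_integrable_continuous_real continuous_intros continuous_T continuous_\<gamma>)
  have "(?y has_vector_derivative Im (T s)) (at s)" if "s \<in> {0<..<L}" for s
    by (rule bounded_linear.has_vector_derivative[OF bounded_linear_Im deriv_at[OF that]])
  then have dy: "(?y has_real_derivative Im (T s)) (at s within I)" if "s \<in> {0<..<L}" for s I
    using that by (auto simp: has_real_derivative_iff_has_vector_derivative intro: has_vector_derivative_at_within)
  have cT: "continuous_on {0<..<L} (\<lambda>s. Im (T s))"
    by (intro continuous_intros continuous_on_subset[OF continuous_T]) auto
  have mem: "Re (\<gamma> s) \<in> hsection K (?y s)" if "s \<in> {0<..<L}" for s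
    using \<gamma>_closure[of s] that by (simp add: hsection_def)
  define P where "P = {s\<in>{0<..<L}. Im (T s) > 0}"
  define N where "N = {s\<in>{0<..<L}. Im (T s) < 0}"
  have "open P" "open N"
    using continuous_open_preimage[OF cT, of "{0<..}"] continuous_open_preimage[OF cT, of "{..<0}"]
    by (auto simp: P_def N_def vimage_def Int_def)
  then have mP: "P \<in> sets lebesgue" and mN: "N \<in> sets lebesgue" by auto
  have sub: "P \<subseteq> {0<..<L}" "N \<subseteq> {0<..<L}" "P \<subseteq> {0..L}" "N \<subseteq> {0..L}" by (auto simp: P_def N_def)
  have R: "?R (?y s) = Re (\<gamma> s)" if "s \<in> P" for s
    using that real_offset(1)[of s] mem[of s]
    by (intro cSup_eq_maximum) (force simp: P_def hsection_def mult_le_0_iff)+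
  have Q: "?Q (?y s) = Re (\<gamma> s)" if "s \<in> N" for s
    using that real_offset(1)[of s] mem[of s]
    by (intro cInf_eq_minimum) (force simp: N_def hsection_def mult_le_0_iff)+
  \<comment> \<open>Two parameters in \<open>P\<close> of equal height both give the right end of
    the same section, hence the same point of the curve.\<close>
  have injP: "inj_on ?y P"
    using inj_onD[OF inj_\<gamma>] sub(1) R by (intro inj_onI) (metis complex_eqI subsetD)
  have injN: "inj_on ?y N"
    using inj_onD[OF inj_\<gamma>] sub(2) Q by (intro inj_onI) (metis complex_eqI subsetD)
  \<comment> \<open>The interior point \<open>z\<close> lies strictly to the left of the right end
    of its section, and this forces an upward tangent there.\<close>
  have exP: "Im z = ?y 0 \<or> (\<exists>s\<in>P. ?y s = Im z)" if z: "z \<in> interior \<Omega>" for z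
  proof -
    obtain s where s: "s \<in> {0..L}" "\<gamma> s = Complex (?R (Im z)) (Im z)"
      using section_at_interior[OF z] by blast
    have zK: "z \<in> K" using z interior_subset closure_subset by blast
    then have "Re z \<in> hsection K (Im z)" by (simp add: hsection_def)
    then have "Re z \<le> ?R (Im z)" using hsection_interval(1)[OF compact_K convex_K] by blast
    then have "Im (T s) > 0" using real_offset(2)[OF s(1) zK] z s(2) by (auto simp: mult_less_0_iff)
    then have "s \<in> P \<or> s = 0 \<or> s = L" using s(1) by (auto simp: P_def)
    then show ?thesis using s(2) closed_curve(1) by (metis complex.sel(2))
  qed
  have exN: "Im z = ?y 0 \<or> (\<exists>s\<in>N. ?y s = Im z)" if z: "z \<in> interior \<Omega>" for z
  proof -
    obtain s where s: "s \<in> {0..L}" "\<gamma> s = Complex (?Q (Im z)) (Im z)"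
      using section_at_interior[OF z] by blast
    have zK: "z \<in> K" using z interior_subset closure_subset by blast
    then have "Re z \<in> hsection K (Im z)" by (simp add: hsection_def)
    then have "?Q (Im z) \<le> Re z" using hsection_interval(1)[OF compact_K convex_K] by blast
    then have "Im (T s) < 0" using real_offset(2)[OF s(1) zK] z s(2) by (auto simp: mult_less_0_iff)
    then have "s \<in> N \<or> s = 0 \<or> s = L" using s(1) by (auto simp: N_def)
    then show ?thesis using s(2) closed_curve(1) by (metis complex.sel(2))
  qed
  obtain i where i: "(?f has_integral i) P" "(?R has_integral i) (Im ` K)"
  proof -
    have aiP: "?f absolutely_integrable_on P" by (rule set_integrable_subset[OF ai mP sub(3)])
    have eq: "\<bar>Im (T s)\<bar> * ?R (?y s) = ?f s" if "s \<in> P" for s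
      using R[OF that] that by (simp add: P_def)
    have "(\<lambda>s. \<bar>Im (T s)\<bar> * ?R (?y s)) absolutely_integrable_on P"
      using eq by (intro absolutely_integrable_spike[OF aiP negligible_empty]) blast
    moreover have "integral P (\<lambda>s. \<bar>Im (T s)\<bar> * ?R (?y s)) = integral P ?f"
      by (rule integral_cong) (rule eq)
    ultimately have "?R absolutely_integrable_on ?y ` P" "integral (?y ` P) ?R = integral P ?f"
      using has_absolute_integral_change_of_variables_1'[OF mP dy injP, of ?R "integral P ?f"] sub by blast+
    then have "(?R has_integral integral P ?f) (?y ` P)"
      by (metis has_integral_integral set_lebesgue_integral_eq_integral(1))
    then have "(?R has_integral integral P ?f) (Im ` K)"
      using has_integral_image_Im_iff[OF exP sub(3)] by blast
    moreover have "(?f has_integral integral P ?f) P"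
      by (rule integrable_integral[OF set_lebesgue_integral_eq_integral(1)[OF aiP]])
    ultimately show ?thesis using that by blast
  qed
  obtain j where j: "(?f has_integral j) N" "(?Q has_integral - j) (Im ` K)"
  proof -
    have aiN: "?f absolutely_integrable_on N" by (rule set_integrable_subset[OF ai mN sub(4)])
    then have aiN': "(\<lambda>s. - ?f s) absolutely_integrable_on N"
      using absolutely_integrable_linear[OF aiN bounded_linear_minus[OF bounded_linear_ident]] by (simp add: o_def)
    \<comment> \<open>On \<open>N\<close> the Jacobian is \<open>- Im (T s)\<close>, so the left
      ends enter with the minus sign they have in the section length.\<close>
    have eq: "\<bar>Im (T s)\<bar> * ?Q (?y s) = - ?f s" if "s \<in> N" for s
      using Q[OF that] that by (simp add: N_def)
    have "(\<lambda>s. \<bar>Im (T s)\<bar> * ?Q (?y s)) absolutely_integrable_on N"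
      using eq by (intro absolutely_integrable_spike[OF aiN' negligible_empty]) blast
    moreover have "integral N (\<lambda>s. \<bar>Im (T s)\<bar> * ?Q (?y s)) = integral N (\<lambda>s. - ?f s)"
      by (rule integral_cong) (rule eq)
    ultimately have "?Q absolutely_integrable_on ?y ` N" "integral (?y ` N) ?Q = integral N (\<lambda>s. - ?f s)"
      using has_absolute_integral_change_of_variables_1'[OF mN dy injN, of ?Q "integral N (\<lambda>s. - ?f s)"] sub by blast+
    then have "(?Q has_integral - integral N ?f) (?y ` N)"
      by (metis has_integral_integral set_lebesgue_integral_eq_integral(1) integral_neg)
    then have "(?Q has_integral - integral N ?f) (Im ` K)"
      using has_integral_image_Im_iff[OF exN sub(4)] by blast
    moreover have "(?f has_integral integral N ?f) N"
      by (rule integrable_integral[OF set_lebesgue_integral_eq_integral(1)[OF aiN]])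
    ultimately show ?thesis using that by blast
  qed
  have "((\<lambda>y. ?R y - ?Q y) has_integral i - - j) (Im ` K)"
    by (rule has_integral_diff[OF i(2) j(2)])
  then have "measure lebesgue K = i + j"
    using measure_eq_integral_sections[OF compact_K convex_K] by fastforce
  moreover have "measure lebesgue K = measure lebesgue \<Omega>"
  proof (rule measure_negligible_symdiff)
    show "\<Omega> \<in> lmeasurable" using convex bounded by (rule measurable_convex)
    have "(\<Omega> - K) \<union> (K - \<Omega>) \<subseteq> frontier \<Omega>"
      using closure_subset interior_subset by (auto simp: frontier_def)
    then show "negligible ((\<Omega> - K) \<union> (K - \<Omega>))"
      using negligible_convex_frontier[OF convex] negligible_subset by blast
  qed
  \<comment> \<open>Apart from the two end parameters, the integrand vanishes outside
    \<open>P\<close> and \<open>N\<close>, because the tangent is horizontal there.\<close>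
  moreover have "(?f has_integral i + j) {0..L}"
  proof -
    have "P \<inter> N = {}" by (auto simp: P_def N_def)
    then have "(?f has_integral i + j) (P \<union> N)"
      by (intro has_integral_Un i j) simp
    then have "((\<lambda>s. if s \<in> P \<union> N then ?f s else 0) has_integral i + j) {0..L}"
      using sub by (subst has_integral_restrict) auto
    then show ?thesis
      by (rule has_integral_spike_finite[rotated 2, of _ _ _ "{0, L}"]) (auto simp: P_def N_def)
  qed
  ultimately show ?thesis by simp
qed

end

section \<open>The minimum of the energy\<close>

context convex_W2p_curve
begin

lemma half_turn_arc_subinterval:
  assumes "0 \<le> a" "a < b" "b \<le> L" "\<phi> b = \<phi> a + pi"
  shows "half_turn_arc \<gamma> T \<phi> \<kappa> a b"
proof
  show "(\<gamma> has_vector_derivative T s) (at s within {a..b})" if "s \<in> {a..b}" for s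
    using deriv[of s] assms that by (auto intro: has_vector_derivative_within_subset)
  show "primitive_on \<phi> \<kappa> a b"
    using assms by (intro primitive_on_subinterval[OF prim_\<phi>])
qed (use assms in \<open>auto simp: \<kappa>_nonneg T_cis\<close>)

text \<open>This form differs from the one in \<open>green_area\<close> by the derivative of a
  function with equal values at both ends. The centre is free, so that the midpoint of the common
  chord can be inserted.\<close>

lemma area_about:
  "((\<lambda>s. Im (cnj (\<gamma> s - m) * T s)) has_integral 2 * measure lebesgue \<Omega>) {0..L}"
proof -
  let ?x = "\<lambda>s. Re (\<gamma> s)" and ?y = "\<lambda>s. Im (\<gamma> s)"
  have dx: "(?x has_real_derivative Re (T s)) (at s within {0..L})"
    and dy: "(?y has_real_derivative Im (T s)) (at s within {0..L})" if "s \<in> {0..L}" for s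
    using bounded_linear.has_vector_derivative[OF bounded_linear_Re deriv[OF that]]
      bounded_linear.has_vector_derivative[OF bounded_linear_Im deriv[OF that]]
    by (simp_all add: has_real_derivative_iff_has_vector_derivative)
  define F where "F = (\<lambda>s. ?x s * ?y s + Re m * ?y s - Im m * ?x s)"
  let ?F' = "\<lambda>s. (Re (T s) * ?y s + Im (T s) * ?x s) + Re m * Im (T s) - Im m * Re (T s)"
  have "(?F' has_integral F L - F 0) {0..L}"
  proof (rule fundamental_theorem_of_calculus)
    fix s assume s: "s \<in> {0..L}"
    show "(F has_vector_derivative ?F' s) (at s within {0..L})"
      unfolding F_def has_real_derivative_iff_has_vector_derivative[symmetric]
      by (intro DERIV_diff DERIV_add DERIV_mult DERIV_cmult dx[OF s] dy[OF s])
  qed (use L_pos in simp)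
  then have F: "(?F' has_integral 0) {0..L}" by (simp add: F_def closed_curve)
  have "((\<lambda>s. 2 * (?x s * Im (T s)) - ?F' s) has_integral 2 * measure lebesgue \<Omega> - 0) {0..L}"
    by (intro has_integral_diff has_integral_mult_right green_area F)
  moreover have "(\<lambda>s. 2 * (?x s * Im (T s)) - ?F' s) = (\<lambda>s. Im (cnj (\<gamma> s - m) * T s))"
    by (rule ext) (simp add: algebra_simps)
  ultimately show ?thesis by simp
qed

lemma energy_bound:
  assumes pos: "measure lebesgue \<Omega> > 0"
  defines "r \<equiv> sqrt (measure lebesgue \<Omega> / pi)"
  shows "2 * pi * r powr (1 - p) \<le> energy_p p L T g"
    and "energy_p p L T g = 2 * pi * r powr (1 - p) \<Longrightarrow> negligible {s\<in>{0..L}. \<kappa> s \<noteq> 1 / r}"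
proof -
  have "\<exists>c\<ge>0. c \<le> L \<and> \<phi> c = \<phi> 0 + pi"
    using L_pos primitive_on_continuous[OF prim_\<phi>] total_turn by (intro IVT') auto
  then obtain c where c: "0 \<le> c" "c \<le> L" "\<phi> c = \<phi> 0 + pi" by blast
  have c0: "0 < c" using c(1,3) by (cases "c = 0") auto
  have cL: "c < L" using c(2,3) total_turn by (cases "c = L") auto
  interpret h1: half_turn_arc \<gamma> T \<phi> \<kappa> 0 c
    using c c0 by (intro half_turn_arc_subinterval) auto
  interpret h2: half_turn_arc \<gamma> T \<phi> \<kappa> c L
    using c cL total_turn by (intro half_turn_arc_subinterval) auto
  \<comment> \<open>Both arcs have the same chord, hence the same midpoint and the same
    \<open>h\<close>; this is why their areas add up to that of \<Omega>.\<close>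
  have m: "h2.m = h1.m" by (simp add: h1.m_def h2.m_def closed_curve add.commute)
  have "h2.h = h1.h" by (rule ext) (simp add: h1.h_def h2.h_def m)
  then have "(h1.h has_integral 2 * h1.area + 2 * h2.area) {0..L}"
    using has_integral_combine[OF c(1,2) h1.h_has_integral] h2.h_has_integral by simp
  then have sum_area: "h1.area + h2.area = measure lebesgue \<Omega>"
    using has_integral_unique[OF area_about[of h1.m]] by (force simp: h1.h_def[abs_def])
  have i1: "(\<lambda>s. \<kappa> s powr p) integrable_on {0..c}" and i2: "(\<lambda>s. \<kappa> s powr p) integrable_on {c..L}"
    using c by (auto intro: integrable_on_subinterval[OF \<kappa>_powr_integrable])
  define E1 E2 where "E1 = integral {0..c} (\<lambda>s. \<kappa> s powr p)" and "E2 = integral {c..L} (\<lambda>s. \<kappa> s powr p)"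
  have E: "energy_p p L T g = E1 + E2"
    unfolding energy_\<kappa> E1_def E2_def
    by (rule Henstock_Kurzweil_Integration.integral_combine[symmetric, OF c(1,2) \<kappa>_powr_integrable])
  define \<beta> where "\<beta> = (1 - p) / 2"
  have \<beta>: "\<beta> < 0" using p by (simp add: \<beta>_def)
  \<comment> \<open>The squared radii of the half discs with the areas of the two arcs; their mean
    is the squared radius of the disc with the area of \<Omega>.\<close>
  define x y where "x = 2 * h1.area / pi" and "y = 2 * h2.area / pi"
  have xy: "x > 0" "y > 0" using h1.area_pos h2.area_pos by (simp_all add: x_def y_def)
  have r: "r > 0" using pos by (simp add: r_def)
  have "x + y = 2 * (h1.area + h2.area) / pi" by (simp add: x_def y_def add_divide_distrib)
  then have rr: "(x + y) / 2 = r\<^sup>2" unfolding sum_area using pos by (simp add: r_def)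
  have e1: "pi * x powr \<beta> \<le> E1" and e2: "pi * y powr \<beta> \<le> E2"
    using h1.energy_ge[OF p i1] h2.energy_ge[OF p i2] by (simp_all add: x_def y_def \<beta>_def E1_def E2_def)
  have e3: "2 * (x * y) powr (\<beta> / 2) \<le> x powr \<beta> + y powr \<beta>"
    by (rule powr_add_ge_geometric_mean(1)[OF xy \<beta>])
  \<comment> \<open>The inequality of arithmetic and geometric means bounds \<open>x * y\<close>
    from above, and the negative exponent reverses it. This treats arcs of unequal area.\<close>
  have "4 * (r\<^sup>2)\<^sup>2 - 4 * (x * y) = (x - y)\<^sup>2"
    unfolding rr[symmetric] by (simp add: power2_eq_square field_simps)
  then have "x * y \<le> (r\<^sup>2)\<^sup>2" using zero_le_power2[of "x - y"] by linarith
  then have "((r\<^sup>2)\<^sup>2) powr (\<beta> / 2) \<le> (x * y) powr (\<beta> / 2)"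
    using xy \<beta> by (intro powr_mono2') auto
  moreover have "((r\<^sup>2)\<^sup>2) powr (\<beta> / 2) = r powr (1 - p)"
  proof -
    have "(r\<^sup>2)\<^sup>2 = r ^ 4" by (simp flip: power_mult)
    then have "(r\<^sup>2)\<^sup>2 = r powr 4" using r by simp
    moreover have "4 * (\<beta> / 2) = 1 - p" by (simp add: \<beta>_def)
    ultimately show ?thesis by (simp only: powr_powr)
  qed
  ultimately have e4: "r powr (1 - p) \<le> (x * y) powr (\<beta> / 2)" by simp
  have e5: "pi * (2 * r powr (1 - p)) \<le> pi * (x powr \<beta> + y powr \<beta>)"
    using e3 e4 by (intro mult_left_mono) auto
  then show "2 * pi * r powr (1 - p) \<le> energy_p p L T g"
    using e1 e2 E by (simp add: algebra_simps)
  show "negligible {s\<in>{0..L}. \<kappa> s \<noteq> 1 / r}" if eq: "energy_p p L T g = 2 * pi * r powr (1 - p)"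
  proof -
    \<comment> \<open>The two arc bounds and the mean inequality add up to the total estimate, so
      equality there makes each of them an equality.\<close>
    have "pi * x powr \<beta> = E1" "pi * y powr \<beta> = E2" "pi * (2 * r powr (1 - p)) = pi * (x powr \<beta> + y powr \<beta>)"
      using e1 e2 e5 E eq by (auto simp: algebra_simps)
    note eqs = this
    then have "2 * r powr (1 - p) = x powr \<beta> + y powr \<beta>" by simp
    then have "x powr \<beta> + y powr \<beta> = 2 * (x * y) powr (\<beta> / 2)" using e3 e4 by linarith
    then have "x = y" by (rule powr_add_ge_geometric_mean(2)[OF xy \<beta>])
    then have xr: "sqrt x = r" "sqrt y = r" using rr r by simp_all
    have "negligible {s\<in>{0..c}. \<kappa> s \<noteq> 1 / sqrt (2 * h1.area / pi)}"
      using eqs(1) by (intro h1.energy_eq_imp[OF p i1]) (simp add: E1_def x_def \<beta>_def)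
    moreover have "negligible {s\<in>{c..L}. \<kappa> s \<noteq> 1 / sqrt (2 * h2.area / pi)}"
      using eqs(2) by (intro h2.energy_eq_imp[OF p i2]) (simp add: E2_def y_def \<beta>_def)
    ultimately have "negligible ({s\<in>{0..c}. \<kappa> s \<noteq> 1 / r} \<union> {s\<in>{c..L}. \<kappa> s \<noteq> 1 / r})"
      using xr by (intro negligible_Un) (simp_all add: x_def y_def)
    then show ?thesis by (rule negligible_subset) auto
  qed
qed

section \<open>The equality case and the energy of discs\<close>

lemma closure_eq_cball:
  assumes r: "r > 0" and ae: "negligible {s\<in>{0..L}. \<kappa> s \<noteq> 1 / r}"
  shows "\<exists>c. closure \<Omega> = cball c r"
proof -
  define N where "N = {s\<in>{0..L}. g s \<noteq> \<i> * curvature T g s * T s} \<union> {s\<in>{0..L}. \<kappa> s \<noteq> curvature T g s}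
    \<union> {s\<in>{0..L}. \<kappa> s \<noteq> 1 / r}"
  have N: "negligible N" unfolding N_def by (intro negligible_Un g_ae \<kappa>_ae ae)
  \<comment> \<open>Multiplied by \<open>\<i> * r\<close> this is the centre of curvature
    \<open>\<gamma> s + \<i> * r * T s\<close>, which does not move when the curvature is
    \<open>1 / r\<close>.\<close>
  have "primitive_on (\<lambda>s. T s + (- \<i> / r) * \<gamma> s) (\<lambda>s. g s + (- \<i> / r) * T s) 0 L"
    by (intro primitive_on_add prim_T primitive_on_linear[OF prim_\<gamma>] bounded_linear_mult_right)
  then have const: "T s + (- \<i> / r) * \<gamma> s = T 0 + (- \<i> / r) * \<gamma> 0" if "s \<in> {0..L}" for s
  proof (rule primitive_on_zero_const[OF _ N _ that])
    fix x assume "x \<in> {0..L} - N"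
    then have "g x = \<i> * curvature T g x * T x" "curvature T g x = 1 / r" by (auto simp: N_def)
    then have "g x = \<i> * (1 / r) * T x" by (simp only:)
    then show "g x + (- \<i> / r) * T x = 0" by simp
  qed
  define c where "c = \<gamma> 0 + \<i> * r * T 0"
  have dist: "\<gamma> s \<in> sphere c r" if s: "s \<in> {0..L}" for s
  proof -
    have "\<i> * r * (T s + (- \<i> / r) * \<gamma> s) = \<i> * r * (T 0 + (- \<i> / r) * \<gamma> 0)"
      by (simp only: const[OF s])
    then have "c - \<gamma> s = \<i> * r * T s" using r by (simp add: c_def algebra_simps)
    then show ?thesis using norm_T[OF s] r by (simp add: dist_norm norm_mult)
  qed
  then have fr: "frontier \<Omega> \<subseteq> sphere c r" unfolding image_\<gamma>[symmetric] by blast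
  \<comment> \<open>The outside of the disc is connected and misses the frontier, so if it met
    \<Omega> it would lie in \<Omega>, which is bounded. The same argument for the open disc, which
    does meet \<Omega>, shows that it is contained in \<Omega>.\<close>
  have sub: "\<Omega> \<subseteq> cball c r"
  proof (rule ccontr)
    assume "\<not> \<Omega> \<subseteq> cball c r"
    then have "- cball c r \<inter> \<Omega> \<noteq> {}" by auto
    moreover have "connected (- cball c r)"
      by (rule connected_complement_bounded_convex) auto
    moreover have "- cball c r \<inter> frontier \<Omega> = {}" using fr by auto
    ultimately have "- cball c r \<subseteq> \<Omega>" using connected_Int_frontier by blast
    then have "bounded (- cball c r \<union> cball c r)"
      using bounded bounded_subset by (intro bounded_Un[THEN iffD2] conjI bounded_cball) blast
    then show False by (simp add: Compl_partition2)
  qed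
  have "ball c r \<subseteq> \<Omega>"
  proof -
    obtain z where z: "z \<in> interior \<Omega>" using int_ne by blast
    have "interior \<Omega> \<subseteq> ball c r" using interior_mono[OF sub] by (simp add: interior_cball)
    then have "ball c r \<inter> \<Omega> \<noteq> {}" using z interior_subset by blast
    moreover have "ball c r \<inter> frontier \<Omega> = {}" using fr by auto
    ultimately show ?thesis using connected_Int_frontier[OF connected_ball] by blast
  qed
  then have "closure (ball c r) \<subseteq> closure \<Omega>" by (rule closure_mono)
  moreover have "closure \<Omega> \<subseteq> cball c r" using sub by (simp add: closure_minimal)
  ultimately have "closure \<Omega> = cball c r" using r by simp
  then show ?thesis by blast
qed

text \<open>The parametrization of the disc is arbitrary, so the position of the tangent is
  recovered from the supporting inequality; it gives curvature \<open>1 / r\<close> almost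
  everywhere, and the total turning gives the length.\<close>

lemma energy_cball:
  assumes \<Omega>: "\<Omega> = cball c r" and r: "r > 0"
  shows "energy_p p L T g = 2 * pi * r powr (1 - p)"
proof -
  have T: "T s = \<i> / r * (\<gamma> s - c)" if s: "s \<in> {0..L}" for s
  proof -
    have n: "norm (c - \<gamma> s) = r" using \<gamma>_frontier[OF s] r by (simp add: \<Omega> dist_norm)
    \<comment> \<open>The point of the disc farthest in the outer normal direction. The supporting
      line at \<open>\<gamma> s\<close> must leave it on the inner side, so the centre is at
      distance at least \<open>r\<close> from that line.\<close>
    have "c - r * \<i> * T s \<in> closure \<Omega>" using norm_T[OF s] r by (simp add: \<Omega> dist_norm norm_mult)
    from support[OF s this] have "Im (cnj (T s) * (c - \<gamma> s) - r * \<i> * (cnj (T s) * T s)) \<ge> 0"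
      by (simp only: algebra_simps)
    then have Im: "Im (cnj (T s) * (c - \<gamma> s)) \<ge> r" by (simp only: T_unit[OF s]) simp
    have "norm (cnj (T s) * (c - \<gamma> s)) = r" using n norm_T[OF s] by (simp add: norm_mult)
    then have "(Re (cnj (T s) * (c - \<gamma> s)))\<^sup>2 + (Im (cnj (T s) * (c - \<gamma> s)))\<^sup>2 = r\<^sup>2"
      by (metis cmod_power2)
    moreover have "(Im (cnj (T s) * (c - \<gamma> s)))\<^sup>2 \<ge> r\<^sup>2" using Im r by (intro power_mono) auto
    ultimately have Re: "Re (cnj (T s) * (c - \<gamma> s)) = 0"
      and "(Im (cnj (T s) * (c - \<gamma> s)))\<^sup>2 = r\<^sup>2"
      using zero_le_power2[of "Re (cnj (T s) * (c - \<gamma> s))"] by (smt (verit) power_eq_0_iff)+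
    then have "Im (cnj (T s) * (c - \<gamma> s)) = r" using Im r by (simp add: power2_eq_iff)
    then have "cnj (T s) * (c - \<gamma> s) = \<i> * r" using Re by (simp add: complex_eq_iff)
    then have "(cnj (T s) * T s) * (c - \<gamma> s) = \<i> * r * T s" by (simp add: mult_ac)
    then have "c - \<gamma> s = \<i> * r * T s" by (simp only: T_unit[OF s] mult_1)
    then have "\<gamma> s - c = - (\<i> * r * T s)" by (simp add: algebra_simps)
    then show ?thesis using r by simp
  qed
  have "primitive_on (\<lambda>s. T s + (- \<i> / r) * \<gamma> s) (\<lambda>s. g s + (- \<i> / r) * T s) 0 L"
    by (intro primitive_on_add prim_T primitive_on_linear[OF prim_\<gamma>] bounded_linear_mult_right)
  moreover have "T s + (- \<i> / r) * \<gamma> s = T 0 + (- \<i> / r) * \<gamma> 0" if "0 \<le> s" "s \<le> L" for s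
  proof -
    have "T s + (- \<i> / r) * \<gamma> s = - \<i> / r * c" if "s \<in> {0..L}" for s
      unfolding T[OF that] right_diff_distrib by simp
    then show ?thesis using that L_pos by simp
  qed
  ultimately have neg: "negligible {s\<in>{0..L}. g s + (- \<i> / r) * T s \<noteq> 0}"
    by (rule negligible_nonzero_of_const)
  have \<kappa>: "\<kappa> s = 1 / r" if s: "s \<in> {0..L}" and eq: "g s + (- \<i> / r) * T s = 0" for s
  proof -
    have "g s = \<i> / r * T s" using eq by (simp add: eq_neg_iff_add_eq_0 algebra_simps)
    then have "cnj (T s) * g s = \<i> / r * (cnj (T s) * T s)" by (simp add: mult_ac)
    then have "cnj (T s) * g s = \<i> / r" by (simp only: T_unit[OF s] mult_1_right)
    then show ?thesis using r by (simp add: \<kappa>_def curvature_def)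
  qed
  have "primitive_on \<phi> (\<lambda>_. 1 / r) 0 L"
    by (rule primitive_on_spike[OF prim_\<phi> neg]) (use \<kappa> in auto)
  from primitive_on_integral[OF this, of 0 L] have L: "L = 2 * pi * r"
    using total_turn L_pos r by (simp add: field_simps)
  have "integral {0..L} (\<lambda>s. \<kappa> s powr p) = integral {0..L} (\<lambda>s. (1 / r) powr p)"
    by (rule integral_spike[OF neg]) (use \<kappa> in auto)
  also have "\<dots> = 2 * pi * (r * (1 / r) powr p)" using L_pos by (simp add: L)
  also have "r * (1 / r) powr p = r powr (1 - p)"
    using r by (simp add: powr_divide powr_diff)
  finally show ?thesis by (simp add: energy_\<kappa>)
qed

end

lemma circle_param:
  assumes r: "r > 0"
  shows "\<exists>\<gamma> L T g. convex_W2p_boundary_param p (cball c r) \<gamma> L T g"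
proof -
  define \<gamma> where "\<gamma> = (\<lambda>s::real. c + r * cis (s / r))"
  define T where "T = (\<lambda>s::real. \<i> * cis (s / r))"
  define g where "g = (\<lambda>s::real. - (1 / r) * cis (s / r))"
  define L where "L = 2 * pi * r"
  have dcis: "((\<lambda>s. cis (s / r)) has_vector_derivative \<i> / r * cis (s / r)) (at s within S)" for s S
  proof -
    have "((\<lambda>s. s *\<^sub>R (\<i> / r)) has_vector_derivative \<i> / r) (at s within S)"
      by (auto intro!: derivative_eq_intros)
    from field_vector_diff_chain_within[OF this has_field_derivative_at_within[OF DERIV_exp]]
    show ?thesis by (simp add: o_def cis_conv_exp scaleR_conv_of_real mult_ac)
  qed
  have d\<gamma>: "(\<gamma> has_vector_derivative T s) (at s within {0..L})" for s
    using has_vector_derivative_add[OF has_vector_derivative_const[of c]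
        has_vector_derivative_mult_right[OF dcis[of s "{0..L}"], of "of_real r"]] r
    by (simp add: \<gamma>_def T_def)
  have dT: "(T has_vector_derivative g s) (at s within {0..L})" for s
    using has_vector_derivative_mult_right[OF dcis[of s "{0..L}"], of \<i>] by (simp add: T_def g_def)
  have cg: "continuous_on {0..L} g" unfolding g_def by (intro continuous_intros) (use r in auto)
  have L: "L > 0" using r by (simp add: L_def)
  have T: "primitive_on T g 0 L" by (rule primitive_on_C1[OF dT cg])
  have ends: "\<gamma> 0 = \<gamma> L" "T 0 = T L" using r by (simp_all add: \<gamma>_def T_def L_def)
  have arc: "arclength_W2p_closed_curve p \<gamma> L T g"
    unfolding arclength_W2p_closed_curve_def
  proof (intro conjI ballI L d\<gamma> ends primitive_on_absint[OF T] primitive_onD[OF T])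
    show "norm (T s) = 1" for s by (simp add: T_def norm_mult)
    have "(\<lambda>s. norm (g s) powr p) = (\<lambda>_. (1 / r) powr p)" using r by (simp add: g_def norm_mult norm_divide)
    then show "(\<lambda>s. norm (g s) powr p) integrable_on {0..L}"
      by (simp add: integrable_const_ivl)
  qed
  have u: "unit_path \<gamma> L = circlepath c r"
    using r by (auto simp: unit_path_def \<gamma>_def L_def circlepath cis_conv_exp mult_ac)
  have "convex_W2p_boundary_param p (cball c r) \<gamma> L T g"
    unfolding convex_W2p_boundary_param_def u
    using r arc by (auto simp: simple_path_circlepath frontier_cball interior_cball dist_norm norm_minus_commute
        intro!: winding_number_circlepath)
  then show ?thesis by blast
qed

text \<open>The first conjunct ensures that the comparison with discs is not vacuous. As \<Omega>
  may contain any part of its frontier, the curve determines it only up to closure, and uniqueness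
  is stated accordingly.\<close>

theorem theorem1p1:
  fixes p a :: real
  assumes "p > 1" and "a > 0"
  defines "r \<equiv> sqrt (a / pi)"
  shows "(\<forall>c. \<exists>\<gamma> L T g. convex_W2p_boundary_param p (cball c r) \<gamma> L T g) \<and>
         (\<forall>\<Omega> \<gamma> L T g c \<gamma>0 L0 T0 g0.
            convex_W2p_boundary_param p \<Omega> \<gamma> L T g \<and> measure lebesgue \<Omega> = a \<and>
            convex_W2p_boundary_param p (cball c r) \<gamma>0 L0 T0 g0 \<longrightarrow>
              energy_p p L0 T0 g0 \<le> energy_p p L T g \<and>
              (energy_p p L0 T0 g0 = energy_p p L T g \<longrightarrow> (\<exists>c'. closure \<Omega> = cball c' r)))"
proof (intro conjI allI impI; (elim conjE)?)
  have r: "r > 0" using assms by (simp add: r_def)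
  show "\<exists>\<gamma> L T g. convex_W2p_boundary_param p (cball c r) \<gamma> L T g" for c
    by (rule circle_param[OF r])
  fix \<Omega> \<gamma> L T g c \<gamma>0 L0 T0 g0
  assume \<Omega>: "convex_W2p_boundary_param p \<Omega> \<gamma> L T g" "measure lebesgue \<Omega> = a"
    and B: "convex_W2p_boundary_param p (cball c r) \<gamma>0 L0 T0 g0"
  \<comment> \<open>A convex set without interior is a null set, so positive area supplies the point
    around which the curve winds.\<close>
  have "interior \<Omega> \<noteq> {}"
  proof
    assume "interior \<Omega> = {}"
    moreover have "convex \<Omega>" using \<Omega>(1) by (simp add: convex_W2p_boundary_param_def)
    ultimately have "negligible \<Omega>" by (simp add: negligible_convex_interior)
    then show False using \<Omega>(2) \<open>a > 0\<close> by (simp add: negligible_imp_measure0)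
  qed
  then interpret curve: convex_W2p_curve p \<Omega> \<gamma> T g L
    using \<Omega> \<open>p > 1\<close> by unfold_locales
  interpret disc: convex_W2p_curve p "cball c r" \<gamma>0 T0 g0 L0
    using B \<open>p > 1\<close> r by unfold_locales (auto simp: interior_cball)
  have e0: "energy_p p L0 T0 g0 = 2 * pi * r powr (1 - p)"
    by (rule disc.energy_cball[OF refl r])
  have sr: "sqrt (measure lebesgue \<Omega> / pi) = r" using \<Omega>(2) by (simp add: r_def)
  have pos: "measure lebesgue \<Omega> > 0" using \<Omega>(2) \<open>a > 0\<close> by simp
  show "energy_p p L0 T0 g0 \<le> energy_p p L T g"
    using curve.energy_bound(1)[OF pos] unfolding sr e0 .
  show "\<exists>c'. closure \<Omega> = cball c' r" if "energy_p p L0 T0 g0 = energy_p p L T g"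
    using curve.energy_bound(2)[OF pos] that unfolding sr e0 by (intro curve.closure_eq_cball[OF r]) simp
qed

end
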